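(* Let $G$ be a tree-cograph. Then $G$ is contact $B_0$-VPG if and only if $G$ is $\{K_5, K_{3,3}, H_0, K_4^-\}$-free.
   Context: All graphs are finite and simple. A contact $B_0$-VPG representation of a graph $G$ assigns to each vertex $v$ a path $P_v$ on a rectangular grid such that: each $P_v$ is a horizontal or a vertical path on the grid (no bends) of length at least one (it contains at least one grid-edge); no two paths share a grid-edge; no two paths cross (no grid-point is an interior point of two distinct paths); and distinct vertices $u,v$ are adjacent if and only if $P_u$ and $P_v$ have at least one grid-point in common. A graph is contact $B_0$-VPG if it has such a representation. Tree-cographs are defined recursively: every tree is a tree-cograph; the disjoint union of tree-cographs is a tree-cograph; the complement of a tree-cograph is a tree-cograph. $K_4^-$ is $K_4$ minus one edge. $H_0$ is the graph composed of three copies of $K_4$ sharing one common vertex, with no further edges. A graph is $\mathcal{H}$-free if no induced subgraph of it is isomorphic to a member of $\mathcal{H}$. *)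

theory Defs
  imports "Graph_Theory.Graph_Theory"
begin

text \<open>
  Finite simple graphs are the symmetric loop-free digraphs \<open>pair_graph\<close>: an edge \<open>uv\<close> is the
  pair of arcs \<open>(u, v)\<close>, \<open>(v, u)\<close>.
\<close>

text \<open>
  The constants \<^const>\<open>forest\<close> and \<^const>\<open>tree\<close> do not fit symmetric digraphs, because there every
  edge yields the closed walk \<open>u, v, u\<close>, which counts as a \<^const>\<open>pre_digraph.cycle\<close>. The cycles of
  the undirected graph are those of length at least 3. Connected graphs are nonempty.
\<close>

definition undirected_tree :: "'a pair_pre_digraph \<Rightarrow> bool" where
  "undirected_tree T \<longleftrightarrow> pair_graph T \<and> Digraph_Component.connected (with_proj T) \<and>
     \<not> (\<exists>p. pre_digraph.cycle (with_proj T) p \<and> length p \<ge> 3)"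

definition graph_union :: "'a pair_pre_digraph \<Rightarrow> 'a pair_pre_digraph \<Rightarrow> 'a pair_pre_digraph" where
  "graph_union G H = \<lparr> pverts = pverts G \<union> pverts H, parcs = parcs G \<union> parcs H \<rparr>"

definition graph_complement :: "'a pair_pre_digraph \<Rightarrow> 'a pair_pre_digraph" where
  "graph_complement G = \<lparr> pverts = pverts G,
     parcs = {(u, v). u \<in> pverts G \<and> v \<in> pverts G \<and> u \<noteq> v \<and> (u, v) \<notin> parcs G} \<rparr>"

inductive tree_cograph :: "'a pair_pre_digraph \<Rightarrow> bool" where
  tree: "undirected_tree T \<Longrightarrow> tree_cograph T"
| disjoint_union: "tree_cograph G \<Longrightarrow> tree_cograph H \<Longrightarrow> pverts G \<inter> pverts H = {} \<Longrightarrow>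
    tree_cograph (graph_union G H)"
| complement: "tree_cograph G \<Longrightarrow> tree_cograph (graph_complement G)"

lemma with_proj_graph_union:
  "with_proj (graph_union G H) = Digraph_Component.union (with_proj G) (with_proj H)"
  by (simp add: graph_union_def Digraph_Component.union_def with_proj_def)

lemma pair_graph_iff:
  "pair_graph G \<longleftrightarrow> finite (pverts G) \<and> parcs G \<subseteq> pverts G \<times> pverts G \<and> sym (parcs G) \<and> irrefl (parcs G)"
proof
  assume "pair_graph G"
  then interpret pair_graph G .
  show "finite (pverts G) \<and> parcs G \<subseteq> pverts G \<times> pverts G \<and> sym (parcs G) \<and> irrefl (parcs G)"
    using pair_finite_verts pair_sym_arcs pair_no_loops in_arcsD1 in_arcsD2
    by (fastforce simp: symmetric_def irrefl_def)
next
  assume *: "finite (pverts G) \<and> parcs G \<subseteq> pverts G \<times> pverts G \<and> sym (parcs G) \<and> irrefl (parcs G)"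
  then have "finite (parcs G)"
    by (meson finite_SigmaI finite_subset)
  with * show "pair_graph G"
    by unfold_locales (auto simp: symmetric_def irrefl_def)
qed

lemma tree_cograph_imp_pair_graph: "tree_cograph G \<Longrightarrow> pair_graph G"
proof (induction rule: tree_cograph.induct)
  case (tree T)
  then show ?case by (simp add: undirected_tree_def)
next
  case (disjoint_union G H)
  then show ?case
    by (auto simp: pair_graph_iff graph_union_def irrefl_def intro: sym_Un)
next
  case (complement G)
  then show ?case
    by (auto simp: pair_graph_iff graph_complement_def irrefl_def sym_def)
qed


text \<open>
  \<open>HPath y a b\<close> runs from \<open>(a, y)\<close> to \<open>(b, y)\<close> and \<open>VPath x a b\<close> from \<open>(x, a)\<close> to \<open>(x, b)\<close> in
  the grid on \<open>int \<times> int\<close>; the parameters describe a path of length at least one iff \<open>a < b\<close>.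
\<close>

datatype grid_path = HPath int int int | VPath int int int

fun path_ok :: "grid_path \<Rightarrow> bool" where
  "path_ok (HPath y a b) \<longleftrightarrow> a < b"
| "path_ok (VPath x a b) \<longleftrightarrow> a < b"

fun grid_points :: "grid_path \<Rightarrow> (int \<times> int) set" where
  "grid_points (HPath y a b) = {a..b} \<times> {y}"
| "grid_points (VPath x a b) = {x} \<times> {a..b}"

fun interior_points :: "grid_path \<Rightarrow> (int \<times> int) set" where
  "interior_points (HPath y a b) = {a<..<b} \<times> {y}"
| "interior_points (VPath x a b) = {x} \<times> {a<..<b}"

fun grid_edges :: "grid_path \<Rightarrow> (int \<times> int) set set" where
  "grid_edges (HPath y a b) = (\<lambda>i. {(i, y), (i + 1, y)}) ` {a..<b}"
| "grid_edges (VPath x a b) = (\<lambda>i. {(x, i), (x, i + 1)}) ` {a..<b}"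

definition contact_B0_VPG_rep :: "'a pair_pre_digraph \<Rightarrow> ('a \<Rightarrow> grid_path) \<Rightarrow> bool" where
  "contact_B0_VPG_rep G P \<longleftrightarrow>
     (\<forall>v \<in> pverts G. path_ok (P v)) \<and>
     (\<forall>u \<in> pverts G. \<forall>v \<in> pverts G. u \<noteq> v \<longrightarrow>
        grid_edges (P u) \<inter> grid_edges (P v) = {} \<and>
        interior_points (P u) \<inter> interior_points (P v) = {} \<and>
        ((u, v) \<in> parcs G \<longleftrightarrow> grid_points (P u) \<inter> grid_points (P v) \<noteq> {}))"

definition contact_B0_VPG :: "'a pair_pre_digraph \<Rightarrow> bool" where
  "contact_B0_VPG G \<longleftrightarrow> (\<exists>P. contact_B0_VPG_rep G P)"


definition induced_free :: "'b pair_pre_digraph set \<Rightarrow> 'a pair_pre_digraph \<Rightarrow> bool" where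
  "induced_free \<H> G \<longleftrightarrow>
     \<not> (\<exists>I. \<exists>H \<in> \<H>. induced_subgraph I (with_proj G) \<and> digraph_iso I (with_proj H))"

definition complete_graph :: "nat \<Rightarrow> nat pair_pre_digraph" where
  "complete_graph n = \<lparr> pverts = {..<n}, parcs = {(u, v). u < n \<and> v < n \<and> u \<noteq> v} \<rparr>"

definition complete_bipartite_graph :: "nat \<Rightarrow> nat \<Rightarrow> nat pair_pre_digraph" where
  "complete_bipartite_graph m n = \<lparr> pverts = {..<m + n},
     parcs = {..<m} \<times> {m..<m + n} \<union> {m..<m + n} \<times> {..<m} \<rparr>"

definition K4_minus :: "nat pair_pre_digraph" where
  "K4_minus = \<lparr> pverts = {..<4}, parcs = parcs (complete_graph 4) - {(0, 1), (1, 0)} \<rparr>"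

text \<open>The three copies of \<open>K\<^sub>4\<close> in \<open>H\<^sub>0\<close> are spanned by \<open>{0, 3 i + 1, 3 i + 2, 3 i + 3}\<close>.\<close>

definition H0 :: "nat pair_pre_digraph" where
  "H0 = \<lparr> pverts = {..<10},
     parcs = (\<Union>i<3. {(u, v). u \<noteq> v \<and> {u, v} \<subseteq> {0, 3 * i + 1, 3 * i + 2, 3 * i + 3}}) \<rparr>"

lemma complete_graph_is_complete_digraph: "K\<^bsub>n\<^esub> (with_proj (complete_graph n))"
  by (auto simp: complete_digraph_pair_def complete_graph_def)

lemma complete_bipartite_graph_is_complete_bipartite_digraph:
  "K\<^bsub>m,n\<^esub> (with_proj (complete_bipartite_graph m n))"
proof -
  have "\<exists>U V. {..<m + n} = U \<union> V \<and> U \<inter> V = {} \<and> card U = m \<and> card V = n \<and>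
      {..<m} \<times> {m..<m + n} \<union> {m..<m + n} \<times> {..<m} = U \<times> V \<union> V \<times> U"
    by (rule exI[of _ "{..<m}"], rule exI[of _ "{m..<m + n}"], intro conjI) auto
  then show ?thesis
    unfolding complete_bipartite_digraph_pair_def complete_bipartite_graph_def by simp
qed

lemma pair_graph_K4_minus: "pair_graph K4_minus"
  by (auto simp: pair_graph_iff K4_minus_def complete_graph_def sym_def irrefl_def)

lemma pair_graph_H0: "pair_graph H0"
  by (auto simp: pair_graph_iff H0_def sym_def irrefl_def)

lemma induced_free_iff_embedding:
  assumes G: "pair_graph G" and HS: "\<And>H. H \<in> \<H> \<Longrightarrow> pair_graph H"
  shows "induced_free \<H> G \<longleftrightarrow>
    \<not> (\<exists>H \<in> \<H>. \<exists>f. inj_on f (pverts H) \<and> f ` pverts H \<subseteq> pverts G \<and>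
         (\<forall>u \<in> pverts H. \<forall>v \<in> pverts H. (u, v) \<in> parcs H \<longleftrightarrow> (f u, f v) \<in> parcs G))"
proof -
  have "(\<exists>I. induced_subgraph I (with_proj G) \<and> digraph_iso I (with_proj H)) \<longleftrightarrow>
      (\<exists>f. inj_on f (pverts H) \<and> f ` pverts H \<subseteq> pverts G \<and>
         (\<forall>u \<in> pverts H. \<forall>v \<in> pverts H. (u, v) \<in> parcs H \<longleftrightarrow> (f u, f v) \<in> parcs G))"
    (is "?L \<longleftrightarrow> ?R") if "H \<in> \<H>" for H
  proof
    have H: "parcs H \<subseteq> pverts H \<times> pverts H"
      using HS[OF that] by (simp add: pair_graph_iff)
    assume ?L
    then obtain I h where I: "induced_subgraph I (with_proj G)"
      and h: "pre_digraph.digraph_isomorphism I h" and eq: "with_proj H = app_iso h I"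
      unfolding digraph_iso_def by blast
    have [simp]: "tail I = fst" "head I = snd"
      using I by (auto simp: induced_subgraph_def subgraph_def compatible_def)
    have sub: "verts I \<subseteq> pverts G"
      and arcsI: "arcs I = {e \<in> parcs G. fst e \<in> verts I \<and> snd e \<in> verts I}"
      using I by (auto simp: induced_subgraph_def subgraph_def)
    define g where "g = iso_verts h"
    have inj: "inj_on g (verts I)"
      using h by (simp add: pre_digraph.digraph_isomorphism_def g_def)
    have vH: "pverts H = g ` verts I"
      using arg_cong[OF eq, of verts] by (simp add: g_def)
    have th: "iso_tail h = fst" "iso_head h = snd"
      using arg_cong[OF eq, of tail] arg_cong[OF eq, of head] by simp_all
    have ia: "iso_arcs h a = (g (fst a), g (snd a))" if "a \<in> arcs I" for a
      using h that by (simp add: pre_digraph.digraph_isomorphism_def g_def th prod_eq_iff)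
    have "parcs H = iso_arcs h ` arcs I"
      using arg_cong[OF eq, of arcs] by simp
    also have "\<dots> = (\<lambda>a. (g (fst a), g (snd a))) ` arcs I"
      using ia by (intro image_cong) auto
    finally have aH: "parcs H = (\<lambda>a. (g (fst a), g (snd a))) ` arcs I" .
    have arc: "(g x, g y) \<in> parcs H \<longleftrightarrow> (x, y) \<in> parcs G" if "x \<in> verts I" "y \<in> verts I" for x y
    proof
      assume "(g x, g y) \<in> parcs H"
      then obtain a where "a \<in> arcs I" "g x = g (fst a)" "g y = g (snd a)"
        unfolding aH by auto
      with arcsI inj that show "(x, y) \<in> parcs G"
        by (metis (mono_tags, lifting) inj_onD mem_Collect_eq prod.collapse)
    next
      assume "(x, y) \<in> parcs G"
      with arcsI that have "(x, y) \<in> arcs I" by simp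
      then show "(g x, g y) \<in> parcs H" unfolding aH by force
    qed
    let ?f = "the_inv_into (verts I) g"
    have "inj_on ?f (pverts H)" unfolding vH by (rule inj_on_the_inv_into[OF inj])
    moreover have "?f ` pverts H \<subseteq> pverts G"
      using sub the_inv_into_f_f[OF inj] unfolding vH by auto
    moreover have "(u, v) \<in> parcs H \<longleftrightarrow> (?f u, ?f v) \<in> parcs G"
      if "u \<in> pverts H" "v \<in> pverts H" for u v
      using that arc the_inv_into_f_f[OF inj] unfolding vH by auto
    ultimately show ?R by blast
  next
    assume ?R
    then obtain f where inj: "inj_on f (pverts H)" and sub: "f ` pverts H \<subseteq> pverts G"
      and arc: "\<And>u v. u \<in> pverts H \<Longrightarrow> v \<in> pverts H \<Longrightarrow> (u, v) \<in> parcs H \<longleftrightarrow> (f u, f v) \<in> parcs G"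
      by blast
    have H: "parcs H \<subseteq> pverts H \<times> pverts H"
      using HS[OF that] by (simp add: pair_graph_iff)
    define S where "S = f ` pverts H"
    define I where "I = with_proj G \<restriction> S"
    interpret G: pair_graph G by (rule G)
    have ind: "induced_subgraph I (with_proj G)"
      using sub unfolding I_def S_def by (intro G.induced_induce) simp
    have wf: "wf_digraph I"
      using ind by (simp add: induced_subgraph_def subgraph_def)
    have aI: "arcs I = {e \<in> parcs G. fst e \<in> S \<and> snd e \<in> S}"
      and vI: "verts I = S" and tI: "tail I = fst" "head I = snd"
      by (auto simp: I_def induce_subgraph_def)
    define g where "g = the_inv_into (pverts H) f"
    have g: "g (f u) = u" if "u \<in> pverts H" for u
      using the_inv_into_f_f[OF inj that] by (simp add: g_def)
    have injg: "inj_on g S" unfolding g_def S_def by (rule inj_on_the_inv_into[OF inj])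
    define h where "h = \<lparr> iso_verts = g, iso_arcs = (\<lambda>a. (g (fst a), g (snd a))),
      iso_head = snd, iso_tail = fst \<rparr>"
    have "pre_digraph.digraph_isomorphism I h"
      unfolding pre_digraph.digraph_isomorphism_def
      using wf injg by (auto simp: h_def aI vI tI inj_on_def)
    moreover have "with_proj H = app_iso h I"
    proof -
      have "pverts H = g ` S"
        using g by (force simp: S_def)
      moreover have "parcs H = (\<lambda>a. (g (fst a), g (snd a))) ` arcs I"
      proof (intro equalityI subsetI)
        fix e assume "e \<in> parcs H"
        then obtain u v where e: "e = (u, v)" "(u, v) \<in> parcs H" by (cases e) auto
        then have uv: "u \<in> pverts H" "v \<in> pverts H" using H by auto
        then have "(f u, f v) \<in> arcs I" using e arc[of u v] by (simp add: aI S_def)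
        moreover have "e = (g (f u), g (f v))" using e uv g by metis
        ultimately show "e \<in> (\<lambda>a. (g (fst a), g (snd a))) ` arcs I"
          by (intro image_eqI[where x = "(f u, f v)"]) simp_all
      next
        fix e assume "e \<in> (\<lambda>a. (g (fst a), g (snd a))) ` arcs I"
        then show "e \<in> parcs H" using arc g by (auto simp: aI S_def)
      qed
      ultimately show ?thesis
        by (simp add: with_proj_def app_iso_def h_def vI)
    qed
    ultimately show ?L using ind unfolding digraph_iso_def by blast
  qed
  note embedding = this
  have "induced_free \<H> G \<longleftrightarrow>
      \<not> (\<exists>H \<in> \<H>. \<exists>I. induced_subgraph I (with_proj G) \<and> digraph_iso I (with_proj H))"
    unfolding induced_free_def by meson
  then show ?thesis by (simp only: embedding cong: bex_cong)
qed

end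

theory Submission
  imports Defs
begin

text \<open>
  Necessity: pairwise touching paths share a grid point (Helly for boxes), and the paths through a
  grid point use disjoint nonempty sets of its four grid edges. Hence cliques have at most four
  vertices, and in a \<open>K\<^sub>4\<close> every path ends at the common point; \<open>K\<^sub>3\<^sub>,\<^sub>3\<close> would need
  three horizontal and three vertical paths, the two middle ones crossing.

  Sufficiency: induct on the tree-cograph, treating a graph together with its complement. A pendant
  vertex or a pendant triangle can be added to any representation, so forests are representable. The
  complement of a disjoint union is a join; without \<open>K\<^sub>4\<close> minus an edge it has a universal vertex
  or is complete bipartite, and the remaining forbidden graphs leave only representable cases. The
  complement of a tree is \<open>K\<^sub>n\<close> plus an isolated vertex, a \<open>P\<^sub>4\<close> or the house.
\<close>

section \<open>Contacts in coordinates\<close>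

text \<open>Complementation preserves neither representability nor the absence of the forbidden
  graphs: five isolated vertices are representable, while their complement is
  \<open>K\<^sub>5\<close>. A hypothesis about a graph alone is therefore useless in the complement
  case, whereas a claim about the graph and its complement merely swaps its halves there. The price
  is that complements of trees and of disjoint unions have to be treated directly. For a join this
  succeeds without any induction hypothesis, because the forbidden graphs alone determine its shape.

  The geometry is reduced to linear inequalities between integer end points, so that contacts of
  concrete paths are decided by arithmetic rather than by reasoning on sets of grid points and grid
  edges.\<close>

fun contact_free :: "grid_path \<Rightarrow> grid_path \<Rightarrow> bool" where
  "contact_free (HPath y a b) (HPath y' a' b') \<longleftrightarrow> y \<noteq> y' \<or> b < a' \<or> b' < a"
| "contact_free (VPath x a b) (VPath x' a' b') \<longleftrightarrow> x \<noteq> x' \<or> b < a' \<or> b' < a"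
| "contact_free (HPath y a b) (VPath x c d) \<longleftrightarrow> x < a \<or> b < x \<or> y < c \<or> d < y"
| "contact_free (VPath x c d) (HPath y a b) \<longleftrightarrow> x < a \<or> b < x \<or> y < c \<or> d < y"

text \<open>Collinear paths may share only an end point; perpendicular paths may meet only where at
  least one of them ends.\<close>

fun noncrossing :: "grid_path \<Rightarrow> grid_path \<Rightarrow> bool" where
  "noncrossing (HPath y a b) (HPath y' a' b') \<longleftrightarrow> y \<noteq> y' \<or> b \<le> a' \<or> b' \<le> a"
| "noncrossing (VPath x a b) (VPath x' a' b') \<longleftrightarrow> x \<noteq> x' \<or> b \<le> a' \<or> b' \<le> a"
| "noncrossing (HPath y a b) (VPath x c d) \<longleftrightarrow> x \<le> a \<or> b \<le> x \<or> y \<le> c \<or> d \<le> y"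
| "noncrossing (VPath x c d) (HPath y a b) \<longleftrightarrow> x \<le> a \<or> b \<le> x \<or> y \<le> c \<or> d \<le> y"

lemma contact_free_commute: "contact_free p q \<longleftrightarrow> contact_free q p"
  by (cases p; cases q) auto

lemma noncrossing_commute: "noncrossing p q \<longleftrightarrow> noncrossing q p"
  by (cases p; cases q) auto

lemma contact_free_iff:
  assumes "path_ok p" "path_ok q"
  shows "contact_free p q \<longleftrightarrow> grid_points p \<inter> grid_points q = {}"
proof -
  have iv: "{a..b} \<inter> {c..d} = {} \<longleftrightarrow> b < c \<or> d < a" if "a < b" "c < d" for a b c d :: int
    using that by (auto simp: Int_atLeastAtMost)
  show ?thesis
    using assms iv
    by (cases p; cases q) (auto simp: Times_Int_Times Int_atLeastAtMost)
qed

text \<open>Perpendicular paths never share a grid edge, so only their interiors matter; for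
  collinear paths disjoint edges already force disjoint interiors.\<close>

lemma noncrossing_iff:
  assumes "path_ok p" "path_ok q"
  shows "noncrossing p q \<longleftrightarrow>
    grid_edges p \<inter> grid_edges q = {} \<and> interior_points p \<inter> interior_points q = {}"
proof -
  have ov: "(\<exists>i::int. a \<le> i \<and> i < b \<and> c \<le> i \<and> i < d) \<longleftrightarrow> \<not> (b \<le> c \<or> d \<le> a)"
    if "a < b" "c < d" for a b c d
  proof
    assume "\<not> (b \<le> c \<or> d \<le> a)"
    then show "\<exists>i::int. a \<le> i \<and> i < b \<and> c \<le> i \<and> i < d"
      using that by (intro exI[of _ "max a c"]) auto
  qed auto
  have im: "f ` A \<inter> g ` B = {} \<longleftrightarrow> \<not> (\<exists>i\<in>A. \<exists>j\<in>B. f i = g j)"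
    for f g :: "int \<Rightarrow> (int \<times> int) set" and A B
    by auto
  have HH: "grid_edges (HPath y a b) \<inter> grid_edges (HPath y' c d) = {} \<longleftrightarrow>
      y \<noteq> y' \<or> \<not> (\<exists>i. a \<le> i \<and> i < b \<and> c \<le> i \<and> i < d)" for y a b y' c d
    by (simp only: grid_edges.simps im) (fastforce simp: doubleton_eq_iff)
  have VV: "grid_edges (VPath y a b) \<inter> grid_edges (VPath y' c d) = {} \<longleftrightarrow>
      y \<noteq> y' \<or> \<not> (\<exists>i. a \<le> i \<and> i < b \<and> c \<le> i \<and> i < d)" for y a b y' c d
    by (simp only: grid_edges.simps im) (fastforce simp: doubleton_eq_iff)
  have HV: "grid_edges (HPath y a b) \<inter> grid_edges (VPath x c d) = {}"
      "grid_edges (VPath x c d) \<inter> grid_edges (HPath y a b) = {}" for y a b x c d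
    by (auto simp: doubleton_eq_iff)
  show ?thesis
  proof (cases p; cases q)
    fix y a b y' c d assume [simp]: "p = HPath y a b" "q = HPath y' c d"
    show ?thesis using assms ov[of a b c d] by (auto simp: HH simp del: grid_edges.simps)
  next
    fix y a b y' c d assume [simp]: "p = VPath y a b" "q = VPath y' c d"
    show ?thesis using assms ov[of a b c d] by (auto simp: VV simp del: grid_edges.simps)
  next
    fix y a b y' c d assume [simp]: "p = HPath y a b" "q = VPath y' c d"
    show ?thesis using assms by (auto simp: HV Times_Int_Times simp del: grid_edges.simps)
  next
    fix y a b y' c d assume [simp]: "p = VPath y' c d" "q = HPath y a b"
    show ?thesis using assms by (auto simp: HV Times_Int_Times simp del: grid_edges.simps)
  qed
qed

text \<open>\<open>E\<close> may relate vertices outside \<open>V\<close>; only its restriction to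
  \<open>V\<close> is represented. One arc set thus serves all induced subgraphs in the inductions
  on vertex sets.\<close>

definition grid_rep :: "'a set \<Rightarrow> ('a \<times> 'a) set \<Rightarrow> ('a \<Rightarrow> grid_path) \<Rightarrow> bool" where
  "grid_rep V E P \<longleftrightarrow> (\<forall>v\<in>V. path_ok (P v)) \<and>
     (\<forall>u\<in>V. \<forall>v\<in>V. u \<noteq> v \<longrightarrow> noncrossing (P u) (P v) \<and>
        ((u, v) \<in> E \<longleftrightarrow> \<not> contact_free (P u) (P v)))"

definition representable :: "'a set \<Rightarrow> ('a \<times> 'a) set \<Rightarrow> bool" where
  "representable V E \<longleftrightarrow> (\<exists>P. grid_rep V E P)"

lemma contact_B0_VPG_iff: "contact_B0_VPG G \<longleftrightarrow> representable (pverts G) (parcs G)"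
proof -
  have "contact_B0_VPG_rep G P \<longleftrightarrow> grid_rep (pverts G) (parcs G) P" for P
    unfolding contact_B0_VPG_rep_def grid_rep_def
    by (rule conj_cong) (auto simp: noncrossing_iff contact_free_iff)
  then show ?thesis by (simp add: contact_B0_VPG_def representable_def)
qed

lemma representable_cong:
  assumes "\<And>u v. u \<in> V \<Longrightarrow> v \<in> V \<Longrightarrow> (u, v) \<in> E \<longleftrightarrow> (u, v) \<in> F"
  shows "representable V E \<longleftrightarrow> representable V F"
  unfolding representable_def grid_rep_def using assms by auto

lemma grid_rep_cong: "(\<And>v. v \<in> V \<Longrightarrow> P v = Q v) \<Longrightarrow> grid_rep V E P \<longleftrightarrow> grid_rep V E Q"
  unfolding grid_rep_def by simp

lemma grid_rep_empty: "grid_rep {} E P"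
  by (simp add: grid_rep_def)

text \<open>As a rewrite rule it verifies concrete representations vertex by vertex. By symmetry of
  \<open>E\<close> and of both contact predicates, a new path is compared with the old ones in one
  order only.\<close>

lemma grid_rep_insert:
  assumes "sym E" "v \<notin> V"
  shows "grid_rep (insert v V) E (P(v := p)) \<longleftrightarrow> grid_rep V E P \<and> path_ok p \<and>
    (\<forall>u\<in>V. noncrossing (P u) p \<and> ((u, v) \<in> E \<longleftrightarrow> \<not> contact_free (P u) p))"
    (is "_ \<longleftrightarrow> _ \<and> _ \<and> (\<forall>u\<in>V. ?C u)")
proof -
  define Q where "Q = P(v := p)"
  define D where "D u w \<longleftrightarrow> noncrossing (Q u) (Q w) \<and> ((u, w) \<in> E \<longleftrightarrow> \<not> contact_free (Q u) (Q w))"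
    for u w
  have sym: "D u w \<longleftrightarrow> D w u" for u w
    using assms(1) by (metis D_def noncrossing_commute contact_free_commute symD)
  have Q: "Q v = p" "\<And>u. u \<in> V \<Longrightarrow> Q u = P u" and C: "\<And>u. u \<in> V \<Longrightarrow> ?C u \<longleftrightarrow> D u v"
    using assms(2) by (auto simp: Q_def D_def)
  have eq: "grid_rep W E Q \<longleftrightarrow> (\<forall>u\<in>W. path_ok (Q u)) \<and> (\<forall>u\<in>W. \<forall>w\<in>W. u \<noteq> w \<longrightarrow> D u w)" for W
    by (simp add: grid_rep_def D_def)
  have "grid_rep V E P \<longleftrightarrow> grid_rep V E Q"
    using Q(2) by (intro grid_rep_cong) auto
  then show ?thesis
    unfolding Q_def[symmetric] eq using C sym Q assms(2) by auto
qed

section \<open>The four forbidden graphs have no representation\<close>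

fun xlo xhi ylo yhi :: "grid_path \<Rightarrow> int" where
  "xlo (HPath y a b) = a" | "xlo (VPath x a b) = x"
| "xhi (HPath y a b) = b" | "xhi (VPath x a b) = x"
| "ylo (HPath y a b) = y" | "ylo (VPath x a b) = a"
| "yhi (HPath y a b) = y" | "yhi (VPath x a b) = b"

lemma grid_points_box: "grid_points p = {xlo p..xhi p} \<times> {ylo p..yhi p}"
  by (cases p) auto

lemma contact_free_box:
  "path_ok p \<Longrightarrow> path_ok q \<Longrightarrow>
    contact_free p q \<longleftrightarrow> xhi p < xlo q \<or> xhi q < xlo p \<or> yhi p < ylo q \<or> yhi q < ylo p"
  by (cases p; cases q) auto

text \<open>Pairwise contact gives \<open>xlo p \<le> xhi q\<close> and
  \<open>ylo p \<le> yhi q\<close> for all pairs, so the largest lower bounds of both coordinates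
  form a common point.\<close>

lemma helly_grid_paths:
  assumes "finite S" "S \<noteq> {}" "\<And>p. p \<in> S \<Longrightarrow> path_ok p"
    and "\<And>p q. p \<in> S \<Longrightarrow> q \<in> S \<Longrightarrow> p \<noteq> q \<Longrightarrow> \<not> contact_free p q"
  shows "\<exists>z. \<forall>p\<in>S. z \<in> grid_points p"
proof -
  have self: "xlo p \<le> xhi p" "ylo p \<le> yhi p" if "path_ok p" for p
    using that by (cases p; simp)+
  have "xlo p \<le> xhi q \<and> ylo p \<le> yhi q" if "p \<in> S" "q \<in> S" for p q
    using that assms(3,4)[of p] assms(3)[of q] assms(4)[of p q] contact_free_box[of p q] self[of p]
    by fastforce
  then have "(Max (xlo ` S), Max (ylo ` S)) \<in> grid_points q" if "q \<in> S" for q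
    using assms(1,2) that by (auto simp: grid_points_box)
  then show ?thesis by blast
qed

text \<open>The numbers name the grid edges at the point: 0 right, 1 left, 2 up, 3 down. Meant for
  points on the path, since the fixed coordinate of the path is not compared.\<close>

fun directions :: "int \<times> int \<Rightarrow> grid_path \<Rightarrow> nat set" where
  "directions (x, y) (HPath _ a b) = (if x < b then {0} else {}) \<union> (if a < x then {1} else {})"
| "directions (x, y) (VPath _ a b) = (if y < b then {2} else {}) \<union> (if a < y then {3} else {})"

lemma directions_disjoint:
  "noncrossing p q \<Longrightarrow> z \<in> grid_points p \<Longrightarrow> z \<in> grid_points q \<Longrightarrow>
    directions z p \<inter> directions z q = {}"
  by (cases z; cases p; cases q) (auto split: if_splits)

lemma directions_nonempty: "path_ok p \<Longrightarrow> z \<in> grid_points p \<Longrightarrow> directions z p \<noteq> {}"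
  by (cases z; cases p) auto

lemma directions_subset: "directions z p \<subseteq> {..<4}"
  by (cases z; cases p) auto

lemma directions_endpoint:
  "path_ok p \<Longrightarrow> z \<in> grid_points p \<Longrightarrow> card (directions z p) \<le> 1 \<Longrightarrow>
    z = (xlo p, ylo p) \<or> z = (xhi p, yhi p)"
  by (cases z; cases p) (auto split: if_splits)

lemma directions_sum:
  assumes "grid_rep V E P" "finite S" "S \<subseteq> V" "\<And>v. v \<in> S \<Longrightarrow> z \<in> grid_points (P v)"
  shows "(\<Sum>v\<in>S. card (directions z (P v))) \<le> 4"
proof -
  have "(\<Sum>v\<in>S. card (directions z (P v))) = card (\<Union>v\<in>S. directions z (P v))"
    using assms directions_disjoint finite_subset[OF directions_subset]
    by (intro card_UN_disjoint[symmetric]) (auto simp: grid_rep_def subset_iff)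
  also have "\<dots> \<le> card {..<4::nat}"
    by (intro card_mono finite_lessThan UN_least directions_subset)
  finally show ?thesis by simp
qed

text \<open>Each path uses at least one of the four grid edges at \<open>z\<close>. With four paths,
  the other three take at least three edges and leave only one for \<open>v\<close>, whose path
  therefore ends at \<open>z\<close>.\<close>

lemma card_at_point:
  assumes "grid_rep V E P" "finite S" "S \<subseteq> V" "\<And>v. v \<in> S \<Longrightarrow> z \<in> grid_points (P v)"
  shows "card S \<le> 4"
    and "card S = 4 \<Longrightarrow> v \<in> S \<Longrightarrow> z = (xlo (P v), ylo (P v)) \<or> z = (xhi (P v), yhi (P v))"
proof -
  have pos: "1 \<le> card (directions z (P v))" if "v \<in> S" for v
    using that assms directions_nonempty[of "P v" z] finite_subset[OF directions_subset]
    by (auto simp: grid_rep_def subset_iff Suc_le_eq card_gt_0_iff)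
  have "card S \<le> (\<Sum>v\<in>S. card (directions z (P v)))"
    using sum_mono[of S "\<lambda>_. 1", OF pos] by simp
  then show "card S \<le> 4" using directions_sum[OF assms] by simp
  assume S: "card S = 4" "v \<in> S"
  have "(\<Sum>w\<in>S - {v}. 1) \<le> (\<Sum>w\<in>S - {v}. card (directions z (P w)))"
    using pos by (intro sum_mono) auto
  then have "card (directions z (P v)) \<le> 1"
    using S directions_sum[OF assms] assms(2) sum.remove[OF assms(2) S(2), of "\<lambda>v. card (directions z (P v))"]
    by simp
  then show "z = (xlo (P v), ylo (P v)) \<or> z = (xhi (P v), yhi (P v))"
    using S assms by (intro directions_endpoint) (auto simp: grid_rep_def subset_iff)
qed

lemma clique_point:
  assumes "grid_rep V E P" "finite S" "S \<subseteq> V" "S \<noteq> {}"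
    and "\<And>u v. u \<in> S \<Longrightarrow> v \<in> S \<Longrightarrow> u \<noteq> v \<Longrightarrow> (u, v) \<in> E"
  obtains z where "\<And>v. v \<in> S \<Longrightarrow> z \<in> grid_points (P v)"
proof -
  have "\<exists>z. \<forall>p\<in>P ` S. z \<in> grid_points p"
  proof (rule helly_grid_paths)
    fix p q assume "p \<in> P ` S" "q \<in> P ` S" "p \<noteq> q"
    then obtain u v where "u \<in> S" "v \<in> S" "p = P u" "q = P v" "u \<noteq> v" by auto
    then show "\<not> contact_free p q" using assms unfolding grid_rep_def by blast
  qed (use assms in \<open>auto simp: grid_rep_def\<close>)
  then show ?thesis using that by blast
qed

text \<open>Two paths with two different common points would be collinear and overlap in a grid
  edge.\<close>

lemma common_point_unique:
  assumes "grid_rep V E P" "u \<in> V" "v \<in> V" "u \<noteq> v"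
    and "{z, w} \<subseteq> grid_points (P u)" "{z, w} \<subseteq> grid_points (P v)"
  shows "z = w"
proof -
  have "noncrossing (P u) (P v)" "path_ok (P u)" "path_ok (P v)"
    using assms by (auto simp: grid_rep_def)
  then show ?thesis using assms(5,6)
    by (cases "P u"; cases "P v"; cases z; cases w) auto
qed

lemma not_representable_K5: "\<not> representable {..<5::nat} (parcs (complete_graph 5))"
proof
  assume "representable {..<5::nat} (parcs (complete_graph 5))"
  then obtain P where P: "grid_rep {..<5::nat} (parcs (complete_graph 5)) P"
    unfolding representable_def by blast
  obtain z where "\<And>v. v \<in> {..<5::nat} \<Longrightarrow> z \<in> grid_points (P v)"
    by (rule clique_point[OF P, of "{..<5}"]) (auto simp: complete_graph_def lessThan_empty_iff)
  from card_at_point(1)[OF P _ _ this, of "{..<5}"] show False by simp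
qed

lemma not_grid_rep_K4_minus: "\<not> representable {..<4::nat} (parcs K4_minus)"
proof
  assume "representable {..<4::nat} (parcs K4_minus)"
  then obtain P where P: "grid_rep {..<4::nat} (parcs K4_minus) P"
    unfolding representable_def by blast
  obtain z where z: "\<And>v. v \<in> {0,2,3} \<Longrightarrow> z \<in> grid_points (P v)"
    by (rule clique_point[OF P, of "{0,2,3}"]) (auto simp: K4_minus_def complete_graph_def)
  obtain w where w: "\<And>v. v \<in> {1,2,3} \<Longrightarrow> w \<in> grid_points (P v)"
    by (rule clique_point[OF P, of "{1,2,3}"]) (auto simp: K4_minus_def complete_graph_def)
  \<comment> \<open>The vertices 2 and 3 lie in both triangles, so their paths contain both points.
    The coinciding point is a contact of the nonadjacent vertices 0 and 1.\<close>
  have "z = w" using z w by (intro common_point_unique[OF P, of 2 3]) auto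
  then have "grid_points (P 0) \<inter> grid_points (P 1) \<noteq> {}" using z w by auto
  moreover have "path_ok (P 0)" "path_ok (P 1)" "(0, 1) \<in> parcs K4_minus \<longleftrightarrow> \<not> contact_free (P 0) (P 1)"
    using P by (simp_all add: grid_rep_def)
  ultimately show False by (simp add: contact_free_iff K4_minus_def)
qed

text \<open>In a \<open>K\<^sub>4\<close> all four paths end at the common point, and a path has only two ends.\<close>

lemma not_representable_H0: "\<not> representable {..<10::nat} (parcs H0)"
proof
  assume "representable {..<10::nat} (parcs H0)"
  then obtain P where P: "grid_rep {..<10::nat} (parcs H0) P"
    unfolding representable_def by blast
  define S where "S i = {0, 3 * i + 1, 3 * i + 2, 3 * i + 3}" for i :: nat
  have S: "finite (S i)" "0 \<in> S i" "card (S i) = 4" for i by (auto simp: S_def)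
  have sub: "S i \<subseteq> {..<10}" if "i < 3" for i using that by (auto simp: S_def)
  have "\<exists>z. \<forall>v\<in>S i. z \<in> grid_points (P v)" if "i < 3" for i
  proof (rule clique_point[OF P S(1) sub])
    fix u v assume "u \<in> S i" "v \<in> S i" "u \<noteq> v"
    then show "(u, v) \<in> parcs H0" using that unfolding S_def H0_def by force
  qed (use that S(2) in auto)
  then obtain z where z: "\<And>i v. i < 3 \<Longrightarrow> v \<in> S i \<Longrightarrow> z i \<in> grid_points (P v)" by metis
  have "z i \<in> {(xlo (P 0), ylo (P 0)), (xhi (P 0), yhi (P 0))}" if "i < 3" for i
    using card_at_point(2)[OF P S(1) sub[OF that] z[OF that]] S that by blast
  from this[of 0] this[of 1] this[of 2] obtain i j where ij: "i < j" "j < 3" "z i = z j"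
    by (metis One_nat_def empty_iff insertE less_Suc_eq numeral_2_eq_2 numeral_3_eq_3 zero_less_Suc)
  have "v \<in> S i \<union> S j \<Longrightarrow> z i \<in> grid_points (P v)" for v
    using z[of i v] z[of j v] ij by auto
  from card_at_point(1)[OF P _ _ this, of "S i \<union> S j"] have "card (S i \<union> S j) \<le> 4"
    using S sub[of i] sub[of j] ij by auto
  \<comment> \<open>One vertex of the second clique already exceeds the bound:
    \<open>3 * j + 1\<close> lies outside \<open>S i\<close>.\<close>
  moreover have "card (insert (3 * j + 1) (S i)) \<le> card (S i \<union> S j)"
    by (intro card_mono) (auto simp: S_def)
  ultimately show False using ij by (simp add: S_def)
qed

section \<open>Orientations of the paths in a \<open>K\<^sub>3\<^sub>,\<^sub>3\<close>\<close>

fun flip :: "grid_path \<Rightarrow> grid_path" where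
  "flip (HPath y a b) = VPath y a b"
| "flip (VPath x a b) = HPath x a b"

fun is_horizontal :: "grid_path \<Rightarrow> bool" where
  "is_horizontal (HPath y a b) \<longleftrightarrow> True"
| "is_horizontal (VPath x a b) \<longleftrightarrow> False"

lemma flip_simps [simp]:
  "path_ok (flip p) \<longleftrightarrow> path_ok p"
  "is_horizontal (flip p) \<longleftrightarrow> \<not> is_horizontal p"
  "noncrossing (flip p) (flip q) \<longleftrightarrow> noncrossing p q"
  "contact_free (flip p) (flip q) \<longleftrightarrow> contact_free p q"
  by (cases p; cases q; auto)+

lemma grid_rep_flip: "grid_rep V E (\<lambda>v. flip (P v)) \<longleftrightarrow> grid_rep V E P"
  by (simp add: grid_rep_def)

text \<open>If \<open>b\<close> were horizontal, \<open>a\<close>, \<open>b\<close> and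
  \<open>a'\<close> would lie in one row, with \<open>b\<close> bridging the gap between the other
  two. A horizontal \<open>b'\<close> would bridge the same gap and meet \<open>b\<close>; a
  vertical \<open>b'\<close> would meet the row in one point, shared by \<open>a\<close> and
  \<open>a'\<close>.\<close>

lemma four_cycle_orientation:
  assumes "contact_free a a'" "contact_free b b'"
    and "\<not> contact_free a b" "\<not> contact_free a b'" "\<not> contact_free a' b" "\<not> contact_free a' b'"
    and "is_horizontal a" "is_horizontal a'"
  shows "\<not> is_horizontal b"
  using assms by (cases a; cases a'; cases b; cases b') auto

lemma median3:
  fixes f :: "nat \<Rightarrow> int"
  assumes "inj_on f A" "card A = 3"
  obtains i j k where "i \<in> A" "j \<in> A" "k \<in> A" "f i < f j" "f j < f k"
proof -
  obtain i j k where A: "A = {i, j, k}" "i \<noteq> j" "j \<noteq> k" "i \<noteq> k"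
    using assms(2) by (auto simp: card_3_iff)
  then have "f i \<noteq> f j" "f j \<noteq> f k" "f i \<noteq> f k" using assms(1) by (auto simp: inj_on_def)
  then show ?thesis
    using that[of i j k] that[of i k j] that[of j i k] that[of j k i] that[of k i j] that[of k j i] A(1)
    by (simp add: neq_iff) metis
qed

lemma not_representable_K33:
  "\<not> representable {..<6::nat} (parcs (complete_bipartite_graph 3 3))"
proof
  let ?E = "parcs (complete_bipartite_graph 3 3)"
  assume "representable {..<6::nat} ?E"
  then obtain P where P: "grid_rep {..<6::nat} ?E P"
    unfolding representable_def by blast
  define A B :: "nat set" where "A = {0, 1, 2}" and "B = {3, 4, 5}"
  \<comment> \<open>Two horizontal paths in \<open>A\<close> may be assumed: two of its three paths
    have the same orientation, and reflection by \<open>flip\<close> turns a vertical pair into a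
    horizontal one.\<close>
  have main: False if P: "grid_rep {..<6::nat} ?E P" and ij: "i \<in> A" "j \<in> A" "i \<noteq> j"
    "is_horizontal (P i)" "is_horizontal (P j)" for P i j
  proof -
    have P': "noncrossing (P u) (P v) \<and> ((u, v) \<in> ?E \<longleftrightarrow> \<not> contact_free (P u) (P v))"
      if "u < 6" "v < 6" "u \<noteq> v" for u v
      using P that unfolding grid_rep_def by blast
    have touch: "\<not> contact_free (P u) (P v)" "\<not> contact_free (P v) (P u)" "noncrossing (P u) (P v)"
      if "u \<in> A" "v \<in> B" for u v
      using that P'[of u v] P'[of v u] by (auto simp: A_def B_def complete_bipartite_graph_def)
    have free: "contact_free (P u) (P v)"
      if "u \<in> A \<and> v \<in> A \<or> u \<in> B \<and> v \<in> B" "u \<noteq> v" for u v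
      using that P'[of u v] by (auto simp: A_def B_def complete_bipartite_graph_def)
    have B: "\<not> is_horizontal (P v)" if v: "v \<in> B" for v
    proof -
      have "\<exists>w\<in>B. w \<noteq> v" by (auto simp: B_def)
      then obtain w where "w \<in> B" "w \<noteq> v" by blast
      then show ?thesis
        using four_cycle_orientation[of "P i" "P j" "P v" "P w"] touch free ij v by blast
    qed
    \<comment> \<open>After reflection the paths of 3 and 4 are the horizontal pair, so the same
      argument runs from \<open>B\<close> to \<open>A\<close>.\<close>
    have A: "is_horizontal (P u)" if u: "u \<in> A" for u
    proof -
      have "\<exists>w\<in>A. w \<noteq> u" by (auto simp: A_def)
      then obtain w where "w \<in> A" "w \<noteq> u" by blast
      moreover have "3 \<in> B" "4 \<in> B" by (auto simp: B_def)
      ultimately show ?thesis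
        using four_cycle_orientation[of "flip (P 3)" "flip (P 4)" "flip (P u)" "flip (P w)"]
          touch free B u by force
    qed
    \<comment> \<open>Two paths in one row that touch the same vertical path would share the point
      where it meets that row.\<close>
    have cross: "ylo (P u) \<noteq> ylo (P u')" if "u \<in> A" "u' \<in> A" "u \<noteq> u'" for u u'
      using that touch[of u 3] touch[of u' 3] free[of u u'] A[of u] A[of u'] B[of 3]
      by (cases "P u"; cases "P u'"; cases "P 3") (auto simp: B_def)
    then have "inj_on (\<lambda>u. ylo (P u)) A" unfolding inj_on_def by blast
    then obtain a1 a2 a3 where a: "a1 \<in> A" "a2 \<in> A" "a3 \<in> A"
      "ylo (P a1) < ylo (P a2)" "ylo (P a2) < ylo (P a3)"
      by (rule median3) (auto simp: A_def)
    have "xlo (P v) \<noteq> xlo (P v')" if "v \<in> B" "v' \<in> B" "v \<noteq> v'" for v v'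
      using that touch[of 0 v] touch[of 0 v'] free[of v v'] B[of v] B[of v'] A[of 0]
      by (cases "P v"; cases "P v'"; cases "P 0") (auto simp: A_def)
    then have "inj_on (\<lambda>v. xlo (P v)) B" unfolding inj_on_def by blast
    then obtain b1 b2 b3 where b: "b1 \<in> B" "b2 \<in> B" "b3 \<in> B"
      "xlo (P b1) < xlo (P b2)" "xlo (P b2) < xlo (P b3)"
      by (rule median3) (auto simp: B_def)
    \<comment> \<open>The path of \<open>b2\<close> reaches the rows of \<open>a1\<close> and
      \<open>a3\<close>, so the row of \<open>a2\<close> is strictly inside its range. Likewise the
      column of \<open>b2\<close> is strictly inside the range of \<open>a2\<close>. Hence the two
      paths cross.\<close>
    show False
      using a b touch(1)[of a1 b2] touch(1)[of a3 b2] touch(1)[of a2 b1] touch(1)[of a2 b3]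
        touch(3)[of a2 b2] A[of a1] A[of a2] A[of a3] B[of b1] B[of b2] B[of b3]
      by (cases "P a1"; cases "P a2"; cases "P a3"; simp; cases "P b1"; cases "P b2"; cases "P b3")
        auto
  qed
  have "\<exists>i\<in>A. \<exists>j\<in>A. i \<noteq> j \<and> (is_horizontal (P i) \<longleftrightarrow> is_horizontal (P j))"
    by (auto simp: A_def)
  then obtain i j where "i \<in> A" "j \<in> A" "i \<noteq> j" "is_horizontal (P i) \<longleftrightarrow> is_horizontal (P j)"
    by blast
  then show False
    using main[of P i j] main[of "\<lambda>v. flip (P v)" i j] P by (auto simp: grid_rep_flip)
qed

section \<open>Induced subgraphs\<close>

definition embeds :: "'b pair_pre_digraph \<Rightarrow> 'a set \<Rightarrow> ('a \<times> 'a) set \<Rightarrow> bool" where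
  "embeds H V E \<longleftrightarrow> (\<exists>f. inj_on f (pverts H) \<and> f ` pverts H \<subseteq> V \<and>
     (\<forall>u \<in> pverts H. \<forall>v \<in> pverts H. (u, v) \<in> parcs H \<longleftrightarrow> (f u, f v) \<in> E))"

abbreviation (input) forbidden_graphs :: "nat pair_pre_digraph set" where
  "forbidden_graphs \<equiv> {complete_graph 5, complete_bipartite_graph 3 3, H0, K4_minus}"

definition forbidden_free :: "'a set \<Rightarrow> ('a \<times> 'a) set \<Rightarrow> bool" where
  "forbidden_free V E \<longleftrightarrow> (\<forall>H\<in>forbidden_graphs. \<not> embeds H V E)"

lemma induced_free_forbidden_iff:
  assumes "pair_graph G"
  shows "induced_free forbidden_graphs G \<longleftrightarrow> forbidden_free (pverts G) (parcs G)"
proof -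
  have "pair_graph H" if "H \<in> forbidden_graphs" for H
    using that pair_graph_H0 pair_graph_K4_minus
    by (auto simp: pair_graph_iff complete_graph_def complete_bipartite_graph_def sym_def irrefl_def)
  from induced_free_iff_embedding[OF assms this] show ?thesis
    unfolding forbidden_free_def embeds_def by blast
qed

lemma embeds_mono:
  assumes "embeds H W F" "W \<subseteq> V"
    and "\<And>u v. u \<in> W \<Longrightarrow> v \<in> W \<Longrightarrow> (u, v) \<in> E \<longleftrightarrow> (u, v) \<in> F"
  shows "embeds H V E"
proof -
  obtain f where "inj_on f (pverts H)" "f ` pverts H \<subseteq> W"
    and f: "\<forall>u \<in> pverts H. \<forall>v \<in> pverts H. (u, v) \<in> parcs H \<longleftrightarrow> (f u, f v) \<in> F"
    using assms(1) unfolding embeds_def by blast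
  moreover have "(f u, f v) \<in> E \<longleftrightarrow> (f u, f v) \<in> F" if "u \<in> pverts H" "v \<in> pverts H" for u v
    using that assms(3) calculation(2) by blast
  ultimately show ?thesis
    unfolding embeds_def using assms(2) by (intro exI[of _ f]) auto
qed

lemma forbidden_free_mono:
  assumes "forbidden_free V E" "W \<subseteq> V"
    and "\<And>u v. u \<in> W \<Longrightarrow> v \<in> W \<Longrightarrow> (u, v) \<in> E \<longleftrightarrow> (u, v) \<in> F"
  shows "forbidden_free W F"
  using assms embeds_mono[of _ W F V E] unfolding forbidden_free_def by blast

lemma forbidden_free_subset: "forbidden_free V E \<Longrightarrow> W \<subseteq> V \<Longrightarrow> forbidden_free W E"
  by (erule forbidden_free_mono) auto

text \<open>The paths are pulled back along the embedding. Representability being hereditary,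
  necessity only has to exclude the four graphs themselves.\<close>

lemma representable_embeds:
  assumes "representable V E" "embeds H V E"
  shows "representable (pverts H) (parcs H)"
proof -
  obtain P where P: "grid_rep V E P"
    using assms(1) unfolding representable_def by blast
  obtain f where f: "inj_on f (pverts H)" "f ` pverts H \<subseteq> V"
    "\<forall>u \<in> pverts H. \<forall>v \<in> pverts H. (u, v) \<in> parcs H \<longleftrightarrow> (f u, f v) \<in> E"
    using assms(2) unfolding embeds_def by blast
  have "grid_rep (pverts H) (parcs H) (\<lambda>v. P (f v))"
    unfolding grid_rep_def
  proof (intro conjI ballI impI)
    fix u v assume uv: "u \<in> pverts H" "v \<in> pverts H" "u \<noteq> v"
    then have "f u \<in> V" "f v \<in> V" "f u \<noteq> f v" using f by (auto simp: inj_on_def)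
    then show "noncrossing (P (f u)) (P (f v))"
      "(u, v) \<in> parcs H \<longleftrightarrow> \<not> contact_free (P (f u)) (P (f v))"
      using P f(3) uv unfolding grid_rep_def by auto
  qed (use P f(2) in \<open>auto simp: grid_rep_def\<close>)
  then show ?thesis unfolding representable_def by blast
qed

lemma representable_imp_forbidden_free:
  assumes "representable V E"
  shows "forbidden_free V E"
proof -
  have "pverts (complete_graph 5) = {..<5}" "pverts (complete_bipartite_graph 3 3) = {..<6}"
    "pverts H0 = {..<10}" "pverts K4_minus = {..<4}"
    by (simp_all add: complete_graph_def complete_bipartite_graph_def H0_def K4_minus_def)
  then show ?thesis
    using representable_embeds[OF assms] not_representable_K5 not_representable_K33
      not_representable_H0 not_grid_rep_K4_minus
    unfolding forbidden_free_def by (metis empty_iff insert_iff)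
qed

section \<open>Consequences of excluding each forbidden graph\<close>

lemma embeds_list:
  assumes "distinct xs" "pverts H = {..<length xs}" "set xs \<subseteq> V"
    and "\<And>i j. i < length xs \<Longrightarrow> j < length xs \<Longrightarrow> (i, j) \<in> parcs H \<longleftrightarrow> (xs ! i, xs ! j) \<in> E"
  shows "embeds H V E"
  unfolding embeds_def using assms
  by (intro exI[of _ "(!) xs"]) (auto simp: inj_on_def nth_eq_iff_index_eq)

lemma forbidden_free_clique:
  assumes "forbidden_free V E" "irrefl E" "S \<subseteq> V"
    and "\<And>u v. u \<in> S \<Longrightarrow> v \<in> S \<Longrightarrow> u \<noteq> v \<Longrightarrow> (u, v) \<in> E"
  shows "card S \<le> 4"
proof (rule ccontr)
  assume "\<not> card S \<le> 4"
  then obtain T where T: "T \<subseteq> S" "card T = 5" "finite T"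
    using obtain_subset_with_card_n[of 5 S] by auto
  then obtain xs where xs: "set xs = T" "distinct xs"
    using finite_distinct_list by blast
  then have len: "length xs = 5" using T distinct_card by fastforce
  have "embeds (complete_graph 5) V E"
  proof (rule embeds_list[OF xs(2)])
    fix i j assume ij: "i < length xs" "j < length xs"
    then have "xs ! i \<in> S" "xs ! j \<in> S" "xs ! i = xs ! j \<longleftrightarrow> i = j"
      using xs T nth_mem[of i xs] nth_mem[of j xs] by (auto simp: nth_eq_iff_index_eq)
    then show "(i, j) \<in> parcs (complete_graph 5) \<longleftrightarrow> (xs ! i, xs ! j) \<in> E"
      using assms(2,4) ij len by (auto simp: complete_graph_def irrefl_def)
  qed (use xs T assms(3) len in \<open>auto simp: complete_graph_def\<close>)
  then show False using assms(1) by (simp add: forbidden_free_def)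
qed

text \<open>The order of the vertices follows the numbering of \<open>K4_minus\<close>: the
  nonadjacent pair comes first.\<close>

lemma forbidden_free_K4_minus:
  assumes "forbidden_free V E" "irrefl E" "sym E" "{a, b, c, d} \<subseteq> V" "a \<noteq> b"
    and "(a, b) \<notin> E" "(a, c) \<in> E" "(a, d) \<in> E" "(b, c) \<in> E" "(b, d) \<in> E" "(c, d) \<in> E"
  shows False
proof -
  have E: "(x, x) \<notin> E" "(x, y) \<in> E \<longleftrightarrow> (y, x) \<in> E" for x y
    using assms(2,3) by (auto simp: irrefl_def dest: symD)
  have [simp]: "a \<noteq> c" "a \<noteq> d" "b \<noteq> c" "b \<noteq> d" "c \<noteq> d" using assms(7-) E by metis+
  have E': "(b, a) \<notin> E" "(c, a) \<in> E" "(d, a) \<in> E" "(c, b) \<in> E" "(d, b) \<in> E" "(d, c) \<in> E"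
    using assms(6-) E by metis+
  have "embeds K4_minus V E"
  proof (rule embeds_list[of "[a, b, c, d]"])
    fix i j assume "i < length [a, b, c, d]" "j < length [a, b, c, d]"
    then have "i \<in> {0, 1, 2, 3}" "j \<in> {0, 1, 2, 3}" by auto
    then show "(i, j) \<in> parcs K4_minus \<longleftrightarrow> ([a, b, c, d] ! i, [a, b, c, d] ! j) \<in> E"
      using assms(6-) E(1) E' by (auto simp: K4_minus_def complete_graph_def)
  qed (use assms(4,5) in \<open>auto simp: K4_minus_def\<close>)
  then show False using assms(1) by (simp add: forbidden_free_def)
qed

lemma forbidden_free_K33:
  assumes "forbidden_free V E" "A \<subseteq> V" "B \<subseteq> V" "A \<inter> B = {}"
    and "\<And>u v. u \<in> A \<Longrightarrow> v \<in> A \<Longrightarrow> (u, v) \<notin> E" "\<And>u v. u \<in> B \<Longrightarrow> v \<in> B \<Longrightarrow> (u, v) \<notin> E"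
    and "\<And>u v. u \<in> A \<Longrightarrow> v \<in> B \<Longrightarrow> (u, v) \<in> E \<and> (v, u) \<in> E"
  shows "card A \<le> 2 \<or> card B \<le> 2"
proof (rule ccontr)
  assume "\<not> (card A \<le> 2 \<or> card B \<le> 2)"
  then have "3 \<le> card A" "3 \<le> card B" by auto
  then obtain A' B' where T: "A' \<subseteq> A" "card A' = 3" "B' \<subseteq> B" "card B' = 3"
    by (meson obtain_subset_with_card_n)
  then obtain a b c d e f where ab: "A' = {a, b, c}" "B' = {d, e, f}"
      "a \<noteq> b" "b \<noteq> c" "a \<noteq> c" "d \<noteq> e" "e \<noteq> f" "d \<noteq> f"
    by (auto simp: card_3_iff)
  then have AB: "a \<in> A" "b \<in> A" "c \<in> A" "d \<in> B" "e \<in> B" "f \<in> B" using T by auto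
  have "embeds (complete_bipartite_graph 3 3) V E"
  proof (rule embeds_list[of "[a, b, c, d, e, f]"])
    fix i j assume "i < length [a, b, c, d, e, f]" "j < length [a, b, c, d, e, f]"
    then have "i \<in> {0, 1, 2, 3, 4, 5}" "j \<in> {0, 1, 2, 3, 4, 5}" by auto
    then show "(i, j) \<in> parcs (complete_bipartite_graph 3 3) \<longleftrightarrow>
        ([a, b, c, d, e, f] ! i, [a, b, c, d, e, f] ! j) \<in> E"
      using AB assms(5-7) by (auto simp: complete_bipartite_graph_def)
  qed (use ab AB assms(2-4) in \<open>auto simp: complete_bipartite_graph_def\<close>)
  then show False using assms(1) by (simp add: forbidden_free_def)
qed

lemma forbidden_free_H0:
  assumes "forbidden_free V E" "irrefl E" "sym E" "b \<in> V"
    and "\<And>v. v \<in> V - {b} \<Longrightarrow> (b, v) \<in> E"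
    and "\<And>i. i < 3 \<Longrightarrow> C i \<subseteq> V - {b}" "\<And>i. i < 3 \<Longrightarrow> card (C i) = 3"
    and "\<And>i j u v. i < 3 \<Longrightarrow> j < 3 \<Longrightarrow> u \<in> C i \<Longrightarrow> v \<in> C j \<Longrightarrow>
       (u, v) \<in> E \<longleftrightarrow> i = j \<and> u \<noteq> v"
    and "\<And>i j. i < j \<Longrightarrow> j < (3::nat) \<Longrightarrow> C i \<inter> C j = {}"
  shows False
proof -
  have "\<exists>g. bij_betw g {0, 1, 2::nat} (C i)" if "i < 3" for i
    using that assms(7)[of i] by (intro finite_same_card_bij) (auto intro: card_ge_0_finite)
  then obtain g where g: "\<And>i. i < 3 \<Longrightarrow> bij_betw (g i) {0, 1, 2::nat} (C i)" by metis
  \<comment> \<open>Vertex 0 is the centre; a vertex \<open>i > 0\<close> has position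
    \<open>(i - 1) mod 3\<close> in copy \<open>(i - 1) div 3\<close>. Truncated subtraction would
    put 0 into copy 0, hence its separate case.\<close>
  define f where "f i = (if i = 0 then b else g ((i - 1) div 3) ((i - 1) mod 3))" for i :: nat
  have fC: "f i \<in> C ((i - 1) div 3)" "(i - 1) div 3 < 3" if "i \<noteq> 0" "i < 10" for i
  proof -
    show *: "(i - 1) div 3 < 3" using that by auto
    have "(i - 1) mod 3 \<in> {0, 1, 2}" by auto
    then show "f i \<in> C ((i - 1) div 3)"
      using g[OF *] that by (auto simp: f_def dest: bij_betwE)
  qed
  have H0: "(i, j) \<in> parcs H0 \<longleftrightarrow>
      i \<noteq> j \<and> (i = 0 \<or> j = 0 \<or> (i - 1) div 3 = (j - 1) div 3)" if "i < 10" "j < 10" for i j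
  proof -
    define K where "K k = {0, 3 * k + 1, 3 * k + 2, 3 * k + 3}" for k :: nat
    have mem: "i \<in> K k \<longleftrightarrow> i = 0 \<or> (i - 1) div 3 = k" for i k
      by (auto simp: K_def)
    have "parcs H0 = (\<Union>k<3. {(u, v). u \<noteq> v \<and> {u, v} \<subseteq> K k})"
      by (simp only: H0_def K_def pair_pre_digraph.select_convs)
    then have "(i, j) \<in> parcs H0 \<longleftrightarrow> i \<noteq> j \<and>
        (\<exists>k<3. (i = 0 \<or> (i - 1) div 3 = k) \<and> (j = 0 \<or> (j - 1) div 3 = k))"
      by (auto simp: mem)
    moreover have "(i - 1) div 3 < 3" "(j - 1) div 3 < 3" using that by auto
    ultimately show ?thesis by metis
  qed
  have inj: "f i = f j \<longleftrightarrow> i = j" if "i < 10" "j < 10" for i j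
  proof
    assume eq: "f i = f j"
    have nz: "f k \<noteq> b" if "k \<noteq> 0" "k < 10" for k
      using fC[OF that] assms(6) by blast
    show "i = j"
    proof (cases "i = 0 \<or> j = 0")
      case True
      then show ?thesis using nz that eq by (metis f_def)
    next
      case False
      then have d: "(i - 1) div 3 = (j - 1) div 3"
        using fC that eq assms(9) by (metis IntI empty_iff linorder_neqE_nat)
      have "inj_on (g ((i - 1) div 3)) {0, 1, 2}"
        using g[OF fC(2)] False that by (simp add: bij_betw_def)
      moreover have "k mod 3 \<in> {0, 1, 2}" for k :: nat by auto
      moreover have "g ((i - 1) div 3) ((i - 1) mod 3) = g ((i - 1) div 3) ((j - 1) mod 3)"
        using eq False d by (simp add: f_def)
      ultimately have "(i - 1) mod 3 = (j - 1) mod 3"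
        by (meson inj_onD)
      then have "i - 1 = j - 1" using d by (metis div_mult_mod_eq)
      then show ?thesis using False by linarith
    qed
  qed simp
  have "embeds H0 V E"
    unfolding embeds_def
  proof (intro exI[of _ f] conjI ballI)
    have V: "pverts H0 = {..<10}" by (simp add: H0_def)
    show "inj_on f (pverts H0)" using inj by (simp add: V inj_on_def)
    have f0: "f 0 = b" by (simp add: f_def)
    have fV': "f i \<in> V - {b}" if "i \<noteq> 0" "i < 10" for i
      using fC[OF that] assms(6) by blast
    then have fV: "f i \<in> V" if "i < 10" for i
      using that assms(4) f0 by (cases "i = 0") blast+
    then show "f ` pverts H0 \<subseteq> V" unfolding V by blast
    fix i j assume "i \<in> pverts H0" "j \<in> pverts H0"
    then have ij: "i < 10" "j < 10" by (auto simp: V)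
    show "(i, j) \<in> parcs H0 \<longleftrightarrow> (f i, f j) \<in> E"
    proof (cases "i = 0 \<or> j = 0")
      case True
      have "(f k, b) \<in> E" "(b, f k) \<in> E" if "k \<noteq> 0" "k < 10" for k
        using assms(5)[OF fV'[OF that]] assms(3) by (auto dest: symD)
      moreover have "(b, b) \<notin> E" using assms(2) by (simp add: irrefl_def)
      ultimately show ?thesis using True ij unfolding H0[OF ij] by (metis f0)
    next
      case False
      then have "i \<noteq> 0" "j \<noteq> 0" by auto
      from assms(8)[OF fC(2)[OF this(1) ij(1)] fC(2)[OF this(2) ij(2)]
          fC(1)[OF this(1) ij(1)] fC(1)[OF this(2) ij(2)]]
      show ?thesis using False inj[OF ij] unfolding H0[OF ij] by blast
    qed
  qed
  then show False using assms(1) by (simp add: forbidden_free_def)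
qed

section \<open>Extending representations\<close>

text \<open>Doubling the grid frees the midpoint of every grid edge; a stub of length one placed there
  has both coordinates of its far end odd and hence meets nothing else.\<close>

fun double :: "grid_path \<Rightarrow> grid_path" where
  "double (HPath y a b) = HPath (2 * y) (2 * a) (2 * b)"
| "double (VPath x a b) = VPath (2 * x) (2 * a) (2 * b)"

fun upper_stub lower_stub :: "grid_path \<Rightarrow> grid_path" where
  "upper_stub (HPath y a b) = VPath (2 * a + 1) (2 * y) (2 * y + 1)"
| "upper_stub (VPath x a b) = HPath (2 * a + 1) (2 * x) (2 * x + 1)"
| "lower_stub (HPath y a b) = VPath (2 * a + 1) (2 * y - 1) (2 * y)"
| "lower_stub (VPath x a b) = HPath (2 * a + 1) (2 * x - 1) (2 * x)"

lemma double_simps [simp]: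
  "path_ok (double p) \<longleftrightarrow> path_ok p"
  "noncrossing (double p) (double q) \<longleftrightarrow> noncrossing p q"
  "contact_free (double p) (double q) \<longleftrightarrow> contact_free p q"
  by (cases p; cases q; auto)+

lemma grid_rep_double: "grid_rep V E P \<Longrightarrow> grid_rep V E (\<lambda>v. double (P v))"
  by (simp add: grid_rep_def)

lemma stub_simps [simp]:
  "path_ok (upper_stub p)" "path_ok (lower_stub p)"
  "noncrossing (upper_stub p) (lower_stub p)" "\<not> contact_free (upper_stub p) (lower_stub p)"
  by (cases p; simp)+

lemma stub_double:
  assumes "path_ok p"
  shows "noncrossing (double p) (upper_stub p)" "\<not> contact_free (double p) (upper_stub p)"
    and "noncrossing (double p) (lower_stub p)" "\<not> contact_free (double p) (lower_stub p)"
  using assms by (cases p; simp)+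

text \<open>Stubs take the path before doubling and start at the midpoint of its first edge. A
  doubled path containing that midpoint contains the whole doubled edge, and
  \<open>noncrossing q p\<close> forbids a shared edge.\<close>

lemma stub_other:
  assumes "path_ok p" "path_ok q" "noncrossing q p"
  shows "noncrossing (double q) (upper_stub p)" "contact_free (double q) (upper_stub p)"
    and "noncrossing (double q) (lower_stub p)" "contact_free (double q) (lower_stub p)"
proof -
  have par: "2 * a + 1 < 2 * b \<longleftrightarrow> a < b" "2 * b < 2 * a + 1 \<longleftrightarrow> b \<le> a"
    "2 * a + 1 \<le> 2 * b \<longleftrightarrow> a < b" "2 * b \<le> 2 * a + 1 \<longleftrightarrow> b \<le> a"
    "2 * a - 1 < 2 * b \<longleftrightarrow> a \<le> b" "2 * b < 2 * a - 1 \<longleftrightarrow> b < a"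
    "2 * a - 1 \<le> 2 * b \<longleftrightarrow> a \<le> b" "2 * b \<le> 2 * a - 1 \<longleftrightarrow> b < a"
    "2 * a \<noteq> 2 * b + 1" "2 * b + 1 \<noteq> 2 * a" for a b :: int
    by presburger+
  show "contact_free (double q) (upper_stub p)"
    using assms by (cases p; cases q) (simp_all add: par, linarith+)
  show "contact_free (double q) (lower_stub p)"
    using assms by (cases p; cases q) (simp_all add: par, linarith+)
  show "noncrossing (double q) (upper_stub p)"
    using assms by (cases p; cases q) (simp_all add: par, linarith+)
  show "noncrossing (double q) (lower_stub p)"
    using assms by (cases p; cases q) (simp_all add: par, linarith+)
qed

lemma representable_pendant:
  assumes "representable V E" "sym E" "p \<in> V" "l \<notin> V"
    and "\<And>u. u \<in> V \<Longrightarrow> (u, l) \<in> E \<longleftrightarrow> u = p"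
  shows "representable (insert l V) E"
proof -
  obtain P where P: "grid_rep V E P" using assms(1) unfolding representable_def by blast
  have ok: "path_ok (P u)" "u \<noteq> p \<Longrightarrow> noncrossing (P u) (P p)" if "u \<in> V" for u
    using P assms(3) that by (auto simp: grid_rep_def)
  have "noncrossing (double (P u)) (upper_stub (P p)) \<and>
      ((u, l) \<in> E \<longleftrightarrow> \<not> contact_free (double (P u)) (upper_stub (P p)))" if "u \<in> V" for u
    using stub_double[of "P p"] stub_other[of "P p" "P u"] ok[OF that] ok[OF assms(3)] assms(5)[OF that]
    by (cases "u = p") auto
  then have "grid_rep (insert l V) E ((\<lambda>v. double (P v))(l := upper_stub (P p)))"
    using grid_rep_double[OF P] by (subst grid_rep_insert[OF assms(2,4)]) simp
  then show ?thesis unfolding representable_def by blast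
qed

text \<open>Both stubs start at the same midpoint, on opposite sides of the path of
  \<open>p\<close>. They meet each other and that path in this point, where both stubs end, so
  nothing crosses.\<close>

lemma representable_pendant_triangle:
  assumes "representable V E" "sym E" "p \<in> V" "l \<notin> V" "m \<notin> V" "(l, m) \<in> E" "l \<noteq> m"
    and "\<And>u. u \<in> V \<Longrightarrow> (u, l) \<in> E \<longleftrightarrow> u = p" "\<And>u. u \<in> V \<Longrightarrow> (u, m) \<in> E \<longleftrightarrow> u = p"
  shows "representable (insert m (insert l V)) E"
proof -
  obtain P where P: "grid_rep V E P" using assms(1) unfolding representable_def by blast
  have ok: "path_ok (P u)" "u \<noteq> p \<Longrightarrow> noncrossing (P u) (P p)" if "u \<in> V" for u
    using P assms(3) that by (auto simp: grid_rep_def)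
  have "noncrossing (double (P u)) (upper_stub (P p)) \<and>
      ((u, l) \<in> E \<longleftrightarrow> \<not> contact_free (double (P u)) (upper_stub (P p)))"
      "noncrossing (double (P u)) (lower_stub (P p)) \<and>
      ((u, m) \<in> E \<longleftrightarrow> \<not> contact_free (double (P u)) (lower_stub (P p)))" if "u \<in> V" for u
    using stub_double[of "P p"] stub_other[of "P p" "P u"] ok[OF that] ok[OF assms(3)]
      assms(8,9)[OF that]
    by (cases "u = p"; auto)+
  moreover have "u \<noteq> l" if "u \<in> V" for u using that assms(4) by auto
  ultimately have "grid_rep (insert m (insert l V)) E
      ((\<lambda>v. double (P v))(l := upper_stub (P p), m := lower_stub (P p)))"
    using grid_rep_double[OF P] assms(2-7) by (simp add: grid_rep_insert)
  then show ?thesis unfolding representable_def by blast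
qed

section \<open>Disjoint unions by translation\<close>

fun shift :: "int \<Rightarrow> grid_path \<Rightarrow> grid_path" where
  "shift d (HPath y a b) = HPath y (a + d) (b + d)"
| "shift d (VPath x a b) = VPath (x + d) a b"

lemma shift_simps [simp]:
  "path_ok (shift d p) \<longleftrightarrow> path_ok p" "xlo (shift d p) = xlo p + d"
  "noncrossing (shift d p) (shift d q) \<longleftrightarrow> noncrossing p q"
  "contact_free (shift d p) (shift d q) \<longleftrightarrow> contact_free p q"
  by (cases p; cases q; auto)+

lemma separated:
  assumes "path_ok p" "path_ok q" "xhi p < xlo q"
  shows "contact_free p q" "noncrossing p q" "contact_free q p" "noncrossing q p"
  using assms by (cases p; cases q; auto)+

lemma representable_disjoint_union:
  assumes "representable V E" "representable W E" "finite V" "finite W" "V \<inter> W = {}"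
    and "\<And>v w. v \<in> V \<Longrightarrow> w \<in> W \<Longrightarrow> (v, w) \<notin> E \<and> (w, v) \<notin> E"
  shows "representable (V \<union> W) E"
proof -
  obtain P Q where P: "grid_rep V E P" and Q: "grid_rep W E Q"
    using assms(1,2) unfolding representable_def by blast
  obtain M where M: "\<And>v. v \<in> V \<Longrightarrow> xhi (P v) \<le> M"
    using assms(3) by (meson finite_imageI bdd_above_finite bdd_above_def imageI)
  obtain N where N: "\<And>w. w \<in> W \<Longrightarrow> N \<le> xlo (Q w)"
    using assms(4) by (meson finite_imageI bdd_below_finite bdd_below_def imageI)
  \<comment> \<open>The shift moves the lower bound \<open>N\<close> to \<open>M + 1\<close>, so all
    paths of \<open>W\<close> lie to the right of all paths of \<open>V\<close>.\<close>
  define R where "R v = (if v \<in> V then P v else shift (M + 1 - N) (Q v))" for v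
  have RV: "R v = P v" if "v \<in> V" for v using that by (simp add: R_def)
  have RW: "R w = shift (M + 1 - N) (Q w)" if "w \<in> W" for w using that assms(5) by (auto simp: R_def)
  have ok: "path_ok (R v)" if "v \<in> V \<union> W" for v
    using that P Q RV RW by (auto simp: grid_rep_def)
  have PV: "noncrossing (P u) (P v) \<and> ((u, v) \<in> E \<longleftrightarrow> \<not> contact_free (P u) (P v))"
    if "u \<in> V" "v \<in> V" "u \<noteq> v" for u v
    using P that unfolding grid_rep_def by blast
  have QW: "noncrossing (Q u) (Q v) \<and> ((u, v) \<in> E \<longleftrightarrow> \<not> contact_free (Q u) (Q v))"
    if "u \<in> W" "v \<in> W" "u \<noteq> v" for u v
    using Q that unfolding grid_rep_def by blast
  have sep: "xhi (R v) < xlo (R w)" if "v \<in> V" "w \<in> W" for v w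
    using that M[of v] N[of w] by (simp add: RV RW)
  have "grid_rep (V \<union> W) E R"
    unfolding grid_rep_def
  proof (intro conjI ballI impI ok)
    fix u v assume uv: "u \<in> V \<union> W" "v \<in> V \<union> W" "u \<noteq> v"
    consider "u \<in> V" "v \<in> V" | "u \<in> W" "v \<in> W" | "u \<in> V" "v \<in> W" | "u \<in> W" "v \<in> V"
      using uv by blast
    then have "noncrossing (R u) (R v) \<and> ((u, v) \<in> E \<longleftrightarrow> \<not> contact_free (R u) (R v))"
    proof cases
      case 1
      then show ?thesis using PV uv(3) RV by simp
    next
      case 2
      then show ?thesis using QW uv(3) RW by simp
    next
      case 3
      then show ?thesis
        using separated[OF ok[OF uv(1)] ok[OF uv(2)] sep[OF 3]] assms(6)[OF 3] by simp
    next
      case 4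
      then show ?thesis
        using separated[OF ok[OF uv(2)] ok[OF uv(1)] sep[OF 4(2,1)]] assms(6)[OF 4(2,1)] by simp
    qed
    then show "noncrossing (R u) (R v)" "(u, v) \<in> E \<longleftrightarrow> \<not> contact_free (R u) (R v)" by auto
  qed
  then show ?thesis unfolding representable_def by blast
qed

lemma representable_singleton: "representable {v} E"
  unfolding representable_def grid_rep_def by (intro exI[of _ "\<lambda>_. HPath 0 0 1"]) auto

section \<open>Joins\<close>

text \<open>The four paths leave the origin to the right, left, up and down. The end
  \<open>(2, 0)\<close> of the path of \<open>b\<close> stays free for a second copy. The outermost
  insertion matches the last update, so that \<open>grid_rep_insert\<close> peels off one vertex at
  a time.\<close>

lemma grid_rep_K4:
  assumes "sym E" "distinct [b, x, y, z]"
    and "\<And>u v. u \<in> {b, x, y, z} \<Longrightarrow> v \<in> {b, x, y, z} \<Longrightarrow> u \<noteq> v \<Longrightarrow> (u, v) \<in> E"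
  shows "grid_rep {z, y, x, b} E ((\<lambda>_. HPath 0 0 2)
    (b := HPath 0 0 2, x := HPath 0 (-1) 0, y := VPath 0 0 1, z := VPath 0 (-1) 0))"
proof -
  have "(b, x) \<in> E" "(b, y) \<in> E" "(b, z) \<in> E" "(x, y) \<in> E" "(x, z) \<in> E" "(y, z) \<in> E"
    using assms(2,3) by auto
  then show ?thesis
    using assms(1,2)
    by - ((subst grid_rep_insert, simp, fastforce)+, simp add: grid_rep_empty)
qed

text \<open>The second triple ends at \<open>(2, 0)\<close>. Only the path of \<open>b\<close>
  passes column 1, so the two triples stay apart.\<close>

lemma representable_two_K4:
  assumes "sym E" "distinct [b, x, y, z, x', y', z']"
    and "\<And>u v. u \<in> {b, x, y, z} \<Longrightarrow> v \<in> {b, x, y, z} \<Longrightarrow> u \<noteq> v \<Longrightarrow> (u, v) \<in> E"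
    and "\<And>u v. u \<in> {b, x', y', z'} \<Longrightarrow> v \<in> {b, x', y', z'} \<Longrightarrow> u \<noteq> v \<Longrightarrow> (u, v) \<in> E"
    and "\<And>u v. u \<in> {x, y, z} \<Longrightarrow> v \<in> {x', y', z'} \<Longrightarrow> (u, v) \<notin> E"
  shows "representable {z', y', x', z, y, x, b} E"
proof -
  have "(b, x') \<in> E" "(b, y') \<in> E" "(b, z') \<in> E" "(x', y') \<in> E" "(x', z') \<in> E" "(y', z') \<in> E"
    using assms(2,4) by auto
  moreover have "(u, x') \<notin> E" "(u, y') \<notin> E" "(u, z') \<notin> E" if "u \<in> {x, y, z}" for u
    using assms(5) that by auto
  moreover have "grid_rep {z, y, x, b} E ((\<lambda>_. HPath 0 0 2)
    (b := HPath 0 0 2, x := HPath 0 (-1) 0, y := VPath 0 0 1, z := VPath 0 (-1) 0))"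
    using assms(2) by (intro grid_rep_K4 assms(1,3)) auto
  ultimately have "grid_rep {z', y', x', z, y, x, b} E ((\<lambda>_. HPath 0 0 2)
    (b := HPath 0 0 2, x := HPath 0 (-1) 0, y := VPath 0 0 1, z := VPath 0 (-1) 0,
     x' := HPath 0 2 3, y' := VPath 2 0 1, z' := VPath 2 (-1) 0))"
    using assms(1,2)
    by - (subst grid_rep_insert, simp, fastforce, subst grid_rep_insert, simp, fastforce,
      subst grid_rep_insert, simp, fastforce, simp)
  then show ?thesis unfolding representable_def by blast
qed

text \<open>The neighbours of a universal vertex \<open>b\<close> induce no path on three vertices, so they fall into
  cliques of at most three vertices; at most two of these have three, and those take the ends of the
  path of \<open>b\<close>.\<close>

lemma representable_universal:
  assumes "finite V" "sym E" "irrefl E" "b \<in> V" "forbidden_free V E"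
    and "\<And>v. v \<in> V - {b} \<Longrightarrow> (b, v) \<in> E"
  shows "representable V E"
  using assms(1,4-6)
proof (induction V rule: finite_psubset_induct)
  case (psubset V)
  have E: "(u, u) \<notin> E" "(u, v) \<in> E \<longleftrightarrow> (v, u) \<in> E" for u v
    using assms(2,3) by (auto simp: irrefl_def dest: symD)
  \<comment> \<open>Closed neighbourhoods away from \<open>b\<close>; by the transitivity proved
    next they are the classes of an equivalence relation.\<close>
  define C where "C v = {w \<in> V - {b}. w = v \<or> (v, w) \<in> E}" for v
  \<comment> \<open>Otherwise the nonadjacent \<open>u\<close> and \<open>w\<close> with their
    common neighbours \<open>v\<close> and \<open>b\<close> induce \<open>K4_minus\<close>.\<close>
  have trans: "(u, w) \<in> E" if "{u, v, w} \<subseteq> V - {b}" "(u, v) \<in> E" "(v, w) \<in> E" "u \<noteq> w" for u v w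
  proof (rule ccontr)
    assume "(u, w) \<notin> E"
    then show False
      using that psubset.prems E by (intro forbidden_free_K4_minus[of V E u w v b] assms(2,3)) auto
  qed
  have self: "v \<in> C v" if "v \<in> V - {b}" for v using that by (simp add: C_def)
  have sub: "C v \<subseteq> V - {b}" for v by (auto simp: C_def)
  have eq: "C u = C v" if "v \<in> V - {b}" "u \<in> C v" for u v
  proof -
    have *: "C u \<subseteq> C v" if "v \<in> V - {b}" "u \<in> C v" for u v
    proof
      fix w assume "w \<in> C u"
      then show "w \<in> C v" using that trans[of v u w] by (auto simp: C_def)
    qed
    have "v \<in> C u" "u \<in> V - {b}" using that E by (auto simp: C_def)
    then show ?thesis using * that by blast
  qed
  have adj: "(u, v) \<in> E \<longleftrightarrow> C u = C v \<and> u \<noteq> v" if "u \<in> V - {b}" "v \<in> V - {b}" for u v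
    using that eq[of u v] E self[of v] by (auto simp: C_def)
  have card3: "card (C v) \<le> 3" if "v \<in> V - {b}" for v
  proof -
    have "(x, y) \<in> E" if xy: "x \<in> insert b (C v)" "y \<in> insert b (C v)" "x \<noteq> y" for x y
    proof (cases "x = b \<or> y = b")
      case True
      then show ?thesis using xy psubset.prems(3) sub E(2) by blast
    next
      case False
      then have "C x = C y" "x \<in> V - {b}" "y \<in> V - {b}"
        using xy eq[OF \<open>v \<in> V - {b}\<close>] sub by auto
      then show ?thesis using adj xy(3) by blast
    qed
    then have "card (insert b (C v)) \<le> 4"
      using sub psubset.prems(1) by (intro forbidden_free_clique[OF psubset.prems(2) assms(3)]) auto
    moreover have "finite (C v)" "b \<notin> C v" using sub psubset.hyps finite_subset by blast+
    ultimately show ?thesis by simp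
  qed
  have smaller: "representable (V - S) E" if "S \<noteq> {}" "S \<subseteq> V - {b}" for S
    using that psubset.prems forbidden_free_subset[of V E "V - S"]
    by (intro psubset.IH) auto
  \<comment> \<open>A class of one vertex is pendant at \<open>b\<close> and a class of two is a
    pendant triangle. Removing it keeps \<open>b\<close> universal, so the induction hypothesis
    applies. Only when all classes have three vertices is an explicit drawing needed.\<close>
  consider v where "v \<in> V - {b}" "card (C v) \<le> 2" | "\<And>v. v \<in> V - {b} \<Longrightarrow> card (C v) = 3"
    using card3 by (metis One_nat_def Suc_1 le_SucE numeral_3_eq_3)
  then show ?case
  proof cases
    case 1
    have fin: "finite (C v)" using sub psubset.hyps finite_subset by blast
    then have "card (C v) \<noteq> 0" using self[OF 1(1)] by auto
    then have "card (C v) = 1 \<or> card (C v) = 2" using 1(2) by linarith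
    then show ?thesis
    proof
      assume "card (C v) = 1"
      then have Cv: "C v = {v}" using self[OF 1(1)] by (auto simp: card_1_singleton_iff)
      have "(u, v) \<in> E \<longleftrightarrow> u = b" if "u \<in> V - {v}" for u
        using that 1(1) psubset.prems(3) Cv E(2) by (auto simp: C_def)
      then have "representable (insert v (V - {v})) E"
        using 1(1) psubset.prems(1) by (intro representable_pendant[OF smaller assms(2), of _ b]) auto
      then show ?thesis using 1(1) by (simp add: insert_absorb)
    next
      assume "card (C v) = 2"
      have "C v \<noteq> {v}" using \<open>card (C v) = 2\<close> by auto
      then obtain w where w0: "w \<in> C v" "w \<noteq> v" using self[OF 1(1)] by blast
      have "{v, w} = C v"
        using fin self[OF 1(1)] w0 \<open>card (C v) = 2\<close> by (intro card_subset_eq) auto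
      then have Cv: "C v = {v, w}" "w \<noteq> v" using w0(2) by auto
      then have w: "w \<in> V - {b}" "C w = {v, w}" using sub[of v] eq[OF 1(1), of w] by auto
      have *: "(u, x) \<in> E \<longleftrightarrow> u = b" if "u \<in> V - {v, w}" "x = v \<or> x = w" for u x
      proof (cases "u = b")
        case True
        then show ?thesis using that 1(1) w(1) psubset.prems(3) by blast
      next
        case False
        then have "u \<in> V - {b}" "x \<in> V - {b}" "C x = C v" using that 1(1) w Cv by auto
        moreover have "u \<notin> C v" using that(1) Cv by blast
        ultimately show ?thesis using adj[of u x] self[of u] False by metis
      qed
      have vw: "(v, w) \<in> E" using adj[OF 1(1) w(1)] Cv w by auto
      have "representable (insert w (insert v (V - {v, w}))) E"
      proof (rule representable_pendant_triangle[OF smaller assms(2), of _ b])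
        show "b \<in> V - {v, w}" using 1(1) w(1) psubset.prems(1) by blast
      qed (use 1(1) w(1) vw Cv(2) * in blast)+
      moreover have "insert w (insert v (V - {v, w})) = V" using 1(1) w(1) by auto
      ultimately show ?thesis by simp
    qed
  next
    case 2
    define D where "D = C ` (V - {b})"
    have finD: "finite D" using psubset.hyps by (simp add: D_def)
    have V: "V = insert b (\<Union>D)" using self sub psubset.prems(1) by (auto simp: D_def)
    have adjD: "(u, v) \<in> E \<longleftrightarrow> X = Y \<and> u \<noteq> v" if "X \<in> D" "Y \<in> D" "u \<in> X" "v \<in> Y" for X Y u v
      using that adj eq sub unfolding D_def by (metis (no_types, lifting) image_iff subsetD)
    have D3: "card X = 3" "X \<subseteq> V - {b}" if "X \<in> D" for X using that 2 sub by (auto simp: D_def)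
    have disj: "X \<inter> Y = {}" if "X \<in> D" "Y \<in> D" "X \<noteq> Y" for X Y
      using that eq unfolding D_def by blast
    have bE: "(b, u) \<in> E" "(u, b) \<in> E" if "u \<in> X" "X \<in> D" for u X
      using that D3(2) psubset.prems(3) E(2) by blast+
    have "card D \<le> 2"
    proof (rule ccontr)
      assume "\<not> card D \<le> 2"
      then have "3 \<le> card D" by simp
      then obtain D' where "D' \<subseteq> D" "card D' = 3" by (meson obtain_subset_with_card_n)
      then obtain X Y Z where XYZ: "X \<in> D" "Y \<in> D" "Z \<in> D" "X \<noteq> Y" "Y \<noteq> Z" "X \<noteq> Z"
        by (auto simp: card_3_iff)
      define F where "F = (!) [X, Y, Z]"
      have less3: "i < 3 \<longleftrightarrow> i = 0 \<or> i = 1 \<or> i = 2" for i :: nat by auto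
      have F: "F i \<in> D" "F i = F j \<longleftrightarrow> i = j" if "i < 3" "j < 3" for i j
        using that XYZ by (auto simp: F_def less3)
      show False
      proof (rule forbidden_free_H0[OF psubset.prems(2) assms(3,2) psubset.prems(1,3)])
        fix i j :: nat assume "i < j" "j < 3"
        then show "F i \<inter> F j = {}" using F[of i j] F[of j j] disj by auto
      next
        fix i j u v assume "i < 3" "j < (3::nat)" "u \<in> F i" "v \<in> F j"
        then show "(u, v) \<in> E \<longleftrightarrow> i = j \<and> u \<noteq> v"
          using F[of i j] F[of j j] adjD by blast
      qed (use F D3 in auto)
    qed
    then consider "D = {}" | X where "D = {X}" | X Y where "D = {X, Y}" "X \<noteq> Y"
    proof -
      have "card D = 0 \<or> card D = 1 \<or> card D = 2" using \<open>card D \<le> 2\<close> by linarith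
      then show ?thesis using that finD by (metis card_0_eq card_1_singletonE card_2_iff)
    qed
    then show ?thesis
    proof cases
      case 1
      then show ?thesis using V representable_singleton by simp
    next
      case (2 X)
      then obtain x y z where X: "X = {x, y, z}" "x \<noteq> y" "y \<noteq> z" "x \<noteq> z"
        using D3(1)[of X] by (auto simp: card_3_iff)
      have "(u, v) \<in> E" if "u \<in> {b, x, y, z}" "v \<in> {b, x, y, z}" "u \<noteq> v" for u v
        using that adjD[of X X u v] bE[of _ X] 2 X(1) by auto
      moreover have "b \<notin> X" using D3(2)[of X] 2 by auto
      moreover have "V = {z, y, x, b}" using V 2 X by auto
      ultimately show ?thesis
        using grid_rep_K4[OF assms(2), of b x y z] X unfolding representable_def by auto
    next
      case (3 X Y)
      obtain x y z where X: "X = {x, y, z}" "x \<noteq> y" "y \<noteq> z" "x \<noteq> z"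
        using 3 D3(1)[of X] by (auto simp: card_3_iff)
      obtain x' y' z' where Y: "Y = {x', y', z'}" "x' \<noteq> y'" "y' \<noteq> z'" "x' \<noteq> z'"
        using 3 D3(1)[of Y] by (auto simp: card_3_iff)
      have "(u, v) \<in> E" if "u \<in> {b, x, y, z}" "v \<in> {b, x, y, z}" "u \<noteq> v" for u v
        using that adjD[of X X u v] bE[of _ X] 3 X(1) by auto
      moreover have "(u, v) \<in> E" if "u \<in> {b, x', y', z'}" "v \<in> {b, x', y', z'}" "u \<noteq> v" for u v
        using that adjD[of Y Y u v] bE[of _ Y] 3 Y(1) by auto
      moreover have "(u, v) \<notin> E" if "u \<in> {x, y, z}" "v \<in> {x', y', z'}" for u v
        using that adjD[of X Y u v] 3 X(1) Y(1) by auto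
      moreover have "b \<notin> X" "b \<notin> Y" "X \<inter> Y = {}" using D3(2)[of X] D3(2)[of Y] disj[of X Y] 3 by auto
      moreover have "V = {z', y', x', z, y, x, b}" using V 3 X Y by auto
      ultimately show ?thesis
        using representable_two_K4[OF assms(2), of b x y z x' y' z'] X Y by auto
    qed
  qed
qed

text \<open>A ladder: \<open>x\<close> and \<open>x'\<close> are the rows 0 and 1, and the vertices
  of \<open>Y\<close> are unit rungs that end on both. The right end \<open>n + 1\<close> gives the
  rows positive length even when \<open>Y\<close> is empty.\<close>

lemma representable_K2n:
  assumes "finite Y" "x \<noteq> x'" "x \<notin> Y" "x' \<notin> Y" "sym E" "(x, x') \<notin> E"
    and "\<And>u v. u \<in> Y \<Longrightarrow> v \<in> Y \<Longrightarrow> (u, v) \<notin> E"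
    and "\<And>v. v \<in> Y \<Longrightarrow> (x, v) \<in> E \<and> (x', v) \<in> E"
  shows "representable ({x, x'} \<union> Y) E"
proof -
  obtain f :: "_ \<Rightarrow> nat" and n where f: "f ` Y = {i. i < n}" "inj_on f Y"
    using finite_imp_inj_to_nat_seg[OF assms(1)] by blast
  have "grid_rep Y E (\<lambda>v. VPath (int (f v)) 0 1)"
    using assms(7) f(2) by (auto simp: grid_rep_def inj_on_def)
  moreover have "int (f v) \<le> int n + 1" "\<not> int n + 1 < int (f v)" if "v \<in> Y" for v
  proof -
    have "f v < n" using f(1) that by blast
    then show "int (f v) \<le> int n + 1" "\<not> int n + 1 < int (f v)" by linarith+
  qed
  moreover have "(v, x) \<in> E" "(v, x') \<in> E" "v \<noteq> x" "v \<noteq> x'" if "v \<in> Y" for v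
    using assms(3-5,8) that by (auto dest: symD)
  ultimately have "grid_rep (insert x' (insert x Y)) E ((\<lambda>v. VPath (int (f v)) 0 1)
      (x := HPath 0 0 (int n + 1), x' := HPath 1 0 (int n + 1)))"
    using assms(2-6) by (auto simp: grid_rep_insert)
  then show ?thesis unfolding representable_def by (auto simp: insert_commute)
qed

text \<open>Without a universal vertex each side contains a nonadjacent pair, since each of its
  vertices is joined to the whole other side. An edge of the other side would complete this pair to
  \<open>K4_minus\<close>. So both sides are independent with at least two vertices, and
  \<open>forbidden_free_K33\<close> leaves exactly two on one of them.\<close>

lemma representable_join:
  assumes "finite A" "finite B" "A \<noteq> {}" "B \<noteq> {}" "A \<inter> B = {}" "sym E" "irrefl E"
    and "\<And>a b. a \<in> A \<Longrightarrow> b \<in> B \<Longrightarrow> (a, b) \<in> E"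
    and "forbidden_free (A \<union> B) E"
  shows "representable (A \<union> B) E"
proof (cases "\<exists>b\<in>A \<union> B. \<forall>v\<in>A \<union> B - {b}. (b, v) \<in> E")
  case True
  then obtain b where "b \<in> A \<union> B" "\<And>v. v \<in> A \<union> B - {b} \<Longrightarrow> (b, v) \<in> E" by blast
  then show ?thesis
    by (intro representable_universal[OF _ assms(6,7) _ assms(9)] finite_UnI assms(1,2))
next
  case False
  have join: "(a, b) \<in> E" "(b, a) \<in> E" if "a \<in> A" "b \<in> B" for a b
    using assms(6,8) that by (auto dest: symD)
  have key: "(\<forall>c\<in>B. \<forall>d\<in>B. (c, d) \<notin> E) \<and> card A \<ge> 2"
    if *: "finite A" "A \<noteq> {}" "\<And>a b. a \<in> A \<Longrightarrow> b \<in> B \<Longrightarrow> (a, b) \<in> E \<and> (b, a) \<in> E"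
      "forbidden_free (A \<union> B) E" "\<not> (\<exists>b\<in>A \<union> B. \<forall>v\<in>A \<union> B - {b}. (b, v) \<in> E)" for A B
  proof -
    obtain a a' where a: "a \<in> A" "a' \<in> A" "a \<noteq> a'" "(a, a') \<notin> E"
    proof -
      obtain a where "a \<in> A" using *(2) by blast
      then have "\<not> (\<forall>v\<in>A \<union> B - {a}. (a, v) \<in> E)" using *(5) by (meson UnI1)
      then obtain v where "v \<in> A \<union> B - {a}" "(a, v) \<notin> E" by blast
      moreover from this have "v \<in> A" using *(3)[of a v] \<open>a \<in> A\<close> by auto
      ultimately show ?thesis using that[of a v] \<open>a \<in> A\<close> by blast
    qed
    then have "card {a, a'} \<le> card A" using *(1) by (intro card_mono) auto
    then have "2 \<le> card A" using a by simp
    moreover have "(c, d) \<notin> E" if "c \<in> B" "d \<in> B" for c d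
    proof
      assume "(c, d) \<in> E"
      show False
        by (rule forbidden_free_K4_minus[OF *(4) assms(7,6), of a a' c d])
          (use a *(3) that \<open>(c, d) \<in> E\<close> in auto)
    qed
    ultimately show ?thesis by blast
  qed
  have ind: "\<And>c d. c \<in> B \<Longrightarrow> d \<in> B \<Longrightarrow> (c, d) \<notin> E" "2 \<le> card A"
      "\<And>c d. c \<in> A \<Longrightarrow> d \<in> A \<Longrightarrow> (c, d) \<notin> E" "2 \<le> card B"
  proof -
    have "(\<forall>c\<in>B. \<forall>d\<in>B. (c, d) \<notin> E) \<and> card A \<ge> 2"
      by (rule key[OF assms(1,3) _ assms(9) False]) (use join in blast)
    moreover have "(\<forall>c\<in>A. \<forall>d\<in>A. (c, d) \<notin> E) \<and> card B \<ge> 2"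
      by (rule key[OF assms(2,4), of A, unfolded Un_commute[of B A], OF _ assms(9) False])
        (use join in blast)
    ultimately show "\<And>c d. c \<in> B \<Longrightarrow> d \<in> B \<Longrightarrow> (c, d) \<notin> E" "2 \<le> card A"
      "\<And>c d. c \<in> A \<Longrightarrow> d \<in> A \<Longrightarrow> (c, d) \<notin> E" "2 \<le> card B"
      by blast+
  qed
  have "card A \<le> 2 \<or> card B \<le> 2"
    by (rule forbidden_free_K33[OF assms(9) _ _ assms(5) ind(3,1)]) (use join in auto)
  then have "card A = 2 \<or> card B = 2" using ind by linarith
  then show ?thesis
  proof
    assume "card A = 2"
    then obtain x x' where A: "A = {x, x'}" "x \<noteq> x'" by (auto simp: card_2_iff)
    then have "x \<in> A" "x' \<in> A" by auto
    then have "representable ({x, x'} \<union> B) E"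
      using assms(5) by (intro representable_K2n[OF assms(2) A(2) _ _ assms(6)] ind conjI join) auto
    then show ?thesis using A(1) by simp
  next
    assume "card B = 2"
    then obtain x x' where B: "B = {x, x'}" "x \<noteq> x'" by (auto simp: card_2_iff)
    then have "x \<in> B" "x' \<in> B" by auto
    then have "representable ({x, x'} \<union> A) E"
      using assms(5) by (intro representable_K2n[OF assms(1) B(2) _ _ assms(6)] ind conjI join) auto
    then show ?thesis using B(1) by (simp add: Un_commute)
  qed
qed

section \<open>Trees and their complements\<close>

text \<open>Cycles are vertex lists closed by the arc from the last vertex to the first. Unlike
  being a tree, the property passes to every subset of the vertices.\<close>

definition acyclic_on :: "'a set \<Rightarrow> ('a \<times> 'a) set \<Rightarrow> bool" where
  "acyclic_on V E \<longleftrightarrow> \<not> (\<exists>xs. length xs \<ge> 3 \<and> distinct xs \<and> set xs \<subseteq> V \<and>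
     successively (\<lambda>u v. (u, v) \<in> E) xs \<and> (last xs, hd xs) \<in> E)"

lemma acyclic_on_subset: "acyclic_on V E \<Longrightarrow> W \<subseteq> V \<Longrightarrow> acyclic_on W E"
  unfolding acyclic_on_def by (meson subset_trans)

lemma acyclic_on_no_triangle:
  assumes "acyclic_on V E" "{a, b, c} \<subseteq> V" "distinct [a, b, c]"
    and "(a, b) \<in> E" "(b, c) \<in> E" "(c, a) \<in> E"
  shows False
proof -
  have "length [a, b, c] \<ge> 3 \<and> distinct [a, b, c] \<and> set [a, b, c] \<subseteq> V \<and>
     successively (\<lambda>u v. (u, v) \<in> E) [a, b, c] \<and> (last [a, b, c], hd [a, b, c]) \<in> E"
    using assms by simp
  then show False using assms(1) unfolding acyclic_on_def by blast
qed

lemma acyclic_on_no_square: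
  assumes "acyclic_on V E" "{a, b, c, d} \<subseteq> V" "distinct [a, b, c, d]"
    and "(a, b) \<in> E" "(b, c) \<in> E" "(c, d) \<in> E" "(d, a) \<in> E"
  shows False
proof -
  have "length [a, b, c, d] \<ge> 3 \<and> distinct [a, b, c, d] \<and> set [a, b, c, d] \<subseteq> V \<and>
     successively (\<lambda>u v. (u, v) \<in> E) [a, b, c, d] \<and> (last [a, b, c, d], hd [a, b, c, d]) \<in> E"
    using assms by simp
  then show False using assms(1) unfolding acyclic_on_def by blast
qed

text \<open>The first vertex of a longest path has all its neighbours on the path, and any neighbour
  other than the second vertex closes a cycle.\<close>

lemma acyclic_on_leaf:
  assumes "finite V" "V \<noteq> {}" "sym E" "irrefl E" "acyclic_on V E"
  obtains v where "v \<in> V" "\<And>u w. u \<in> V \<Longrightarrow> w \<in> V \<Longrightarrow> (v, u) \<in> E \<Longrightarrow> (v, w) \<in> E \<Longrightarrow> u = w"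
proof -
  define P where "P xs \<longleftrightarrow> xs \<noteq> [] \<and> distinct xs \<and> set xs \<subseteq> V \<and>
    successively (\<lambda>u v. (u, v) \<in> E) xs" for xs
  obtain v0 where "v0 \<in> V" using assms(2) by blast
  then have "P [v0]" by (simp add: P_def)
  moreover have "\<forall>xs. P xs \<longrightarrow> length xs \<le> card V"
  proof (intro allI impI)
    fix xs assume "P xs"
    then have "card (set xs) \<le> card V" "distinct xs"
      using card_mono[OF assms(1)] by (auto simp: P_def)
    then show "length xs \<le> card V" by (simp add: distinct_card)
  qed
  ultimately have "\<exists>xs. P xs \<and> (\<forall>ys. P ys \<longrightarrow> length ys \<le> length xs)"
    using ex_has_greatest_nat[of P "[v0]" length "Suc (card V)"] by (simp add: less_Suc_eq_le)
  then obtain xs where xs: "P xs" "\<And>ys. P ys \<Longrightarrow> length ys \<le> length xs"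
    by blast
  obtain v ys where vys: "xs = v # ys" using xs(1) by (cases xs) (auto simp: P_def)
  have E: "(u, w) \<in> E \<longleftrightarrow> (w, u) \<in> E" for u w using assms(3) by (meson symD)
  have on: "u \<in> set ys" if "u \<in> V" "(v, u) \<in> E" for u
  proof (rule ccontr)
    assume "u \<notin> set ys"
    moreover have "u \<noteq> v" using that(2) assms(4) by (auto simp: irrefl_def)
    ultimately have "P (u # xs)"
      using xs(1) that E[of u v] by (simp add: P_def vys)
    then show False using xs(2) by fastforce
  qed
  have hd: "u = hd ys" if u: "u \<in> V" "(v, u) \<in> E" for u
  proof (rule ccontr)
    assume "u \<noteq> hd ys"
    obtain y zs where ys: "ys = y # zs" using on[OF u] by (cases ys) auto
    with \<open>u \<noteq> hd ys\<close> on[OF u] have "u \<in> set zs" by simp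
    then obtain as bs where "zs = as @ u # bs" by (meson split_list)
    then have split: "xs = (v # y # as @ [u]) @ bs" by (simp add: vys ys)
    have "P ((v # y # as @ [u]) @ bs)" using xs(1) unfolding split .
    then have "P (v # y # as @ [u])"
      unfolding P_def successively_append_iff by auto
    moreover have "(last (v # y # as @ [u]), hd (v # y # as @ [u])) \<in> E" using u(2) E by simp
    moreover have "length (v # y # as @ [u]) \<ge> 3" by simp
    ultimately show False using assms(5) unfolding acyclic_on_def P_def by blast
  qed
  show ?thesis
  proof (rule that[of v])
    show "v \<in> V" using xs(1) by (simp add: P_def vys)
  qed (use hd in blast)
qed

text \<open>A vertex with at most one neighbour is deleted. It returns as a pendant vertex, or as a
  separate component if it has no neighbour.\<close>

lemma representable_acyclic:
  assumes "finite V" "sym E" "irrefl E" "acyclic_on V E"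
  shows "representable V E"
  using assms(1,4)
proof (induction V rule: finite_psubset_induct)
  case (psubset V)
  show ?case
  proof (cases "V = {}")
    case True
    then show ?thesis by (simp add: representable_def grid_rep_empty)
  next
    case False
    then obtain v where v: "v \<in> V"
      "\<And>u w. u \<in> V \<Longrightarrow> w \<in> V \<Longrightarrow> (v, u) \<in> E \<Longrightarrow> (v, w) \<in> E \<Longrightarrow> u = w"
      using acyclic_on_leaf[OF psubset.hyps _ assms(2,3) psubset.prems] by blast
    have E: "(u, w) \<in> E \<longleftrightarrow> (w, u) \<in> E" "(u, u) \<notin> E" for u w
      using assms(2,3) by (auto simp: irrefl_def dest: symD)
    have IH: "representable (V - {v}) E"
      using v(1) acyclic_on_subset[OF psubset.prems] by (intro psubset.IH) auto
    have V: "insert v (V - {v}) = V" using v(1) by blast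
    show ?thesis
    proof (cases "\<exists>p\<in>V. (v, p) \<in> E")
      case True
      then obtain p where p: "p \<in> V" "(v, p) \<in> E" by blast
      then have "p \<noteq> v" using E(2) by blast
      have "representable (insert v (V - {v})) E"
      proof (rule representable_pendant[OF IH assms(2), of p])
        fix u assume "u \<in> V - {v}"
        then show "(u, v) \<in> E \<longleftrightarrow> u = p" using v(2) p E(1) by (meson DiffD1)
      qed (use p \<open>p \<noteq> v\<close> in auto)
      then show ?thesis using V by simp
    next
      case False
      have "representable ((V - {v}) \<union> {v}) E"
        using psubset.hyps False E(1)
        by (intro representable_disjoint_union IH representable_singleton) auto
      then show ?thesis using V by simp
    qed
  qed
qed

lemma undirected_tree_acyclic:
  assumes "undirected_tree T"
  shows "acyclic_on (pverts T) (parcs T)"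
proof -
  interpret pair_graph T using assms by (simp add: undirected_tree_def)
  have walk: "awalk (hd xs) (zip xs (tl xs)) (last xs) \<and> awalk_verts (hd xs) (zip xs (tl xs)) = xs"
    if "xs \<noteq> []" "set xs \<subseteq> pverts T" "successively (\<lambda>u v. (u, v) \<in> parcs T) xs" for xs
    using that
  proof (induction xs rule: induct_list012)
    case (3 x y zs)
    then show ?case by (auto simp: awalk_Cons_iff)
  qed (auto simp: awalk_Nil_iff)
  show ?thesis
    unfolding acyclic_on_def
  proof (intro notI, elim exE conjE)
    fix xs assume xs: "3 \<le> length xs" "distinct xs" "set xs \<subseteq> pverts T"
      "successively (\<lambda>u v. (u, v) \<in> parcs T) xs" "(last xs, hd xs) \<in> parcs T"
    then have ne: "xs \<noteq> []" by auto
    \<comment> \<open>A closed walk with as many arcs as \<open>xs\<close> has vertices. Its vertex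
      sequence without the head is a rotation of \<open>xs\<close>, hence distinct as
      \<open>cycle\<close> demands.\<close>
    define p where "p = zip xs (tl xs) @ [(last xs, hd xs)]"
    note w = walk[OF ne xs(3,4)]
    have hd: "hd xs \<in> pverts T" using ne xs(3) by auto
    have aw: "awalk (hd xs) p (hd xs)"
      using w xs(5) hd unfolding p_def by (simp add: awalk_Cons_iff awalk_Nil_iff)
    have "awalk_verts (hd xs) p = xs @ [hd xs]"
      using awalk_verts_append[OF aw[unfolded p_def]] w unfolding p_def by simp
    then have "distinct (tl (awalk_verts (hd xs) p))"
      using xs(2) ne by (cases xs) auto
    then have "cycle p" using aw unfolding cycle_def by (auto simp: p_def)
    moreover have "length p \<ge> 3" using xs(1) by (simp add: p_def)
    ultimately show False using assms unfolding undirected_tree_def by blast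
  qed
qed

text \<open>A set without outgoing edges is closed under reachability. In this form connectedness
  enters the treatment of complements of trees.\<close>

lemma undirected_tree_boundary_edge:
  assumes "undirected_tree T" "S \<subseteq> pverts T" "S \<noteq> {}" "S \<noteq> pverts T"
  shows "\<exists>u\<in>S. \<exists>v\<in>pverts T - S. (u, v) \<in> parcs T"
proof (rule ccontr)
  assume none: "\<not> ?thesis"
  interpret pair_graph T using assms(1) by (simp add: undirected_tree_def)
  obtain u v where uv: "u \<in> S" "v \<in> pverts T - S" using assms(2-4) by blast
  have "Digraph_Component.connected (with_proj T)" using assms(1) by (simp add: undirected_tree_def)
  then have "u \<rightarrow>\<^sup>*\<^bsub>with_proj (mk_symmetric (with_proj T))\<^esub> v"
    using uv assms(2) by (auto simp: connected_def strongly_connected_def)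
  then have "u \<rightarrow>\<^sup>*\<^bsub>with_proj T\<^esub> v"
    using reachable_mk_symmetric_eq[OF sym_arcs] by simp
  then have "v \<in> S"
  proof (induction rule: reachable_induct)
    case base
    then show ?case using uv by simp
  next
    case (step x y)
    then show ?case using none in_arcsD2 by auto
  qed
  then show False using uv by blast
qed

text \<open>With a leaf \<open>l\<close> and its neighbour \<open>p\<close>, the vertices off \<open>p\<close> are pairwise adjacent because the
  complement has no \<open>K\<^sub>4\<close> minus an edge. Hence the tree is a star, a \<open>P\<^sub>4\<close> or a \<open>P\<^sub>5\<close>, and the
  complement of a \<open>P\<^sub>5\<close> is the house.\<close>

lemma representable_cotree:
  assumes V: "finite V" "V \<noteq> {}" and E: "sym E" "irrefl E" "acyclic_on V E"
    and boundary: "\<And>S. S \<subseteq> V \<Longrightarrow> S \<noteq> {} \<Longrightarrow> S \<noteq> V \<Longrightarrow> \<exists>u\<in>S. \<exists>v\<in>V - S. (u, v) \<in> E"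
    and F: "F = {(u, v). u \<in> V \<and> v \<in> V \<and> u \<noteq> v \<and> (u, v) \<notin> E}"
    and free: "forbidden_free V F"
  shows "representable V F"
proof -
  have comm: "(u, v) \<in> E \<longleftrightarrow> (v, u) \<in> E" for u v using E(1) by (meson symD)
  have irr: "(u, u) \<notin> E" for u using E(2) by (simp add: irrefl_def)
  have F': "sym F" "irrefl F" using comm unfolding F by (auto simp: sym_def irrefl_def)
  obtain l where l: "l \<in> V" "\<And>u w. u \<in> V \<Longrightarrow> w \<in> V \<Longrightarrow> (l, u) \<in> E \<Longrightarrow> (l, w) \<in> E \<Longrightarrow> u = w"
    using acyclic_on_leaf[OF V E] by blast
  show ?thesis
  proof (cases "V = {l}")
    case True
    then show ?thesis using representable_singleton by simp
  next
    case False
    then obtain p where p: "p \<in> V" "p \<noteq> l" "(l, p) \<in> E"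
      using boundary[of "{l}"] l(1) by auto
    have leaf: "(l, u) \<in> E \<longleftrightarrow> u = p" "(u, l) \<in> E \<longleftrightarrow> u = p" if "u \<in> V" for u
      using l(2) p that comm by blast+
    have triangle: "(a, c) \<notin> E" if "a \<in> V" "b \<in> V" "c \<in> V" "(a, b) \<in> E" "(b, c) \<in> E" for a b c
    proof
      assume "(a, c) \<in> E"
      then have "distinct [a, b, c]" "(c, a) \<in> E" using that irr comm by auto
      then show False using acyclic_on_no_triangle[OF E(3), of a b c] that by auto
    qed
    define N where "N = {v \<in> V. (p, v) \<in> E}"
    define R where "R = V - insert p N"
    have N: "l \<in> N" "p \<notin> N" "N \<subseteq> V" using l(1) p comm irr by (auto simp: N_def)
    have VNR: "V = insert p (N \<union> R)" using p(1) N by (auto simp: R_def)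
    have R: "x \<in> V" "x \<noteq> p" "x \<noteq> l" "(p, x) \<notin> E" "(x, p) \<notin> E" if "x \<in> R" for x
      using that N comm by (auto simp: R_def N_def)
    show ?thesis
    proof (cases "R = {}")
      case True
      \<comment> \<open>The tree is a star with centre \<open>p\<close>. In the complement
        \<open>p\<close> is isolated and the leaf \<open>l\<close> is universal among the other
        vertices.\<close>
      have "representable N F"
      proof (rule representable_universal[OF _ F' N(1)])
        fix v assume "v \<in> N - {l}"
        then show "(l, v) \<in> F" using N l(1) leaf unfolding F by blast
      qed (use N V(1) free forbidden_free_subset finite_subset in blast)+
      moreover have "(v, w) \<notin> F \<and> (w, v) \<notin> F" if "v \<in> N" "w \<in> {p}" for v w
        using that comm by (auto simp: N_def F)
      ultimately have "representable (N \<union> {p}) F"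
        using N V(1) finite_subset
        by (intro representable_disjoint_union representable_singleton) auto
      then show ?thesis using VNR True by simp
    next
      case False
      have "R \<noteq> V" "R \<subseteq> V" using p(1) by (auto simp: R_def)
      \<comment> \<open>The edge leaving \<open>R\<close> ends in \<open>N\<close>, since
        \<open>p\<close> has no neighbour in \<open>R\<close>, and not in \<open>l\<close>, whose
        only neighbour is \<open>p\<close>. So \<open>l\<close>, \<open>p\<close>, \<open>q\<close>,
        \<open>x\<close> is a path of the tree.\<close>
      then obtain x q where xq: "x \<in> R" "q \<in> V - R" "(x, q) \<in> E" using boundary[of R] False by blast
      have "q \<noteq> p" using R(5)[OF xq(1)] xq(3) by blast
      then have "q \<in> N" using xq(2) VNR by blast
      then have q: "q \<in> N" "q \<in> V" "(p, q) \<in> E" "(q, p) \<in> E"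
        using comm[of q p] by (simp_all add: N_def)
      have "q \<noteq> l" using leaf(2)[OF R(1)] xq(1,3) R(2) by blast
      \<comment> \<open>Otherwise the complement has a \<open>K4_minus\<close> with nonadjacent pair
        \<open>q\<close>, \<open>x\<close> and common neighbours \<open>l\<close>, \<open>m\<close>:
        a tree edge from \<open>m\<close> to \<open>q\<close> or to \<open>x\<close> would close a
        triangle or a square.\<close>
      have "m = l \<or> m = q" if m: "m \<in> N" for m
      proof (rule ccontr)
        assume ne: "\<not> (m = l \<or> m = q)"
        have mV: "m \<in> V" "m \<noteq> p" "(p, m) \<in> E" "(m, p) \<in> E" "m \<noteq> x"
          using m N comm[of m p] R(4)[OF xq(1)] by (auto simp: N_def)
        have "(q, m) \<notin> E" using triangle[OF q(2) p(1) mV(1)] q mV by blast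
        moreover have "(x, m) \<notin> E"
        proof
          assume "(x, m) \<in> E"
          then show False
            using acyclic_on_no_square[OF E(3), of p q x m] p(1) q mV R[OF xq(1)] ne \<open>q \<noteq> p\<close> xq(3)
              irr comm by auto
        qed
        ultimately show False
          using mV q l(1) xq R[OF xq(1)] ne \<open>q \<noteq> l\<close> \<open>q \<noteq> p\<close> leaf[of q] leaf[of x] leaf[of m] comm irr
          by (intro forbidden_free_K4_minus[OF free F'(2,1), of q x l m]) (auto simp: F)
      qed
      then have Nlq: "N = {l, q}" using N q by blast
      \<comment> \<open>Here the tree edge between \<open>l\<close> and \<open>p\<close> supplies
        the nonadjacent pair of the complement.\<close>
      have clique: "(y, z) \<in> E" if "y \<in> R" "z \<in> R" "y \<noteq> z" for y z
      proof (rule ccontr)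
        assume "(y, z) \<notin> E"
        then show False
          using that R[of y] R[of z] leaf[of y] leaf[of z] l(1) p
          by (intro forbidden_free_K4_minus[OF free F'(2,1), of l p y z]) (auto simp: F)
      qed
      note x = R[OF xq(1)]
      have qx: "(q, x) \<in> E" "q \<noteq> x" using xq comm by auto
      \<comment> \<open>In the complement \<open>q\<close>, \<open>l\<close>, \<open>x\<close>,
        \<open>p\<close> is a path. The paths of \<open>l\<close>, \<open>x\<close> and
        \<open>p\<close> are the left, bottom and right sides of a square with open top, and
        \<open>q\<close> stands on the upper end of \<open>l\<close>. A fifth vertex
        \<open>y\<close> becomes the top side, which gives the house with roof
        \<open>q\<close>.\<close>
      have base: "grid_rep {x, q, p, l} F ((\<lambda>_. HPath 0 0 1)(l := VPath 0 (-2) 0,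
        p := VPath 2 (-2) 0, q := VPath 0 0 1, x := HPath (-2) 0 2))"
      proof -
        have "(l, p) \<notin> F" "(l, q) \<in> F" "(p, q) \<notin> F" "(l, x) \<in> F" "(p, x) \<in> F" "(q, x) \<notin> F"
          using p l(1) q x qx leaf[of q] leaf[of x] \<open>q \<noteq> l\<close> \<open>q \<noteq> p\<close> by (auto simp: F)
        moreover have "distinct [x, q, p, l]" using p(2) x(2,3) qx(2) \<open>q \<noteq> l\<close> \<open>q \<noteq> p\<close> by auto
        ultimately show ?thesis
          using F'(1)
          by - ((subst grid_rep_insert, simp, fastforce)+, auto simp: grid_rep_empty)
      qed
      show ?thesis
      proof (cases "R = {x}")
        case True
        then have "V = {x, q, p, l}" using VNR Nlq by auto
        then show ?thesis using base unfolding representable_def by auto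
      next
        case False
        then obtain y where y: "y \<in> R" "y \<noteq> x" using xq(1) by blast
        have "z = x \<or> z = y" if "z \<in> R" for z
        proof (rule ccontr)
          assume "\<not> (z = x \<or> z = y)"
          then show False
            using triangle[of x y z] clique that y xq(1) R(1) by metis
        qed
        then have "R = {x, y}" using y xq(1) by blast
        then have V5: "V = insert y {x, q, p, l}" using VNR Nlq by auto
        note yR = R[OF y(1)]
        have xy: "(x, y) \<in> E" using clique xq(1) y by blast
        have "(q, y) \<notin> E" using triangle[OF q(2) x(1) yR(1) qx(1) xy] .
        then have "(x, y) \<notin> F" "(q, y) \<in> F" "(p, y) \<in> F" "(l, y) \<in> F" "y \<notin> {x, q, p, l}"
          using xy q p l(1) yR y(2) leaf[of y] xq by (auto simp: F)
        then have "grid_rep (insert y {x, q, p, l}) F ((\<lambda>_. HPath 0 0 1)(l := VPath 0 (-2) 0,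
          p := VPath 2 (-2) 0, q := VPath 0 0 1, x := HPath (-2) 0 2, y := HPath 0 0 2))"
          using base p(2) x(2,3) qx(2) \<open>q \<noteq> l\<close> \<open>q \<noteq> p\<close>
          by (subst grid_rep_insert[OF F'(1)]) auto
        then show ?thesis using V5 unfolding representable_def by blast
      qed
    qed
  qed
qed

section \<open>Tree-cographs\<close>

text \<open>Joins and complements of trees are treated for nonempty parts; connectedness provides
  them at the base of the recursion.\<close>

lemma tree_cograph_nonempty: "tree_cograph G \<Longrightarrow> pverts G \<noteq> {}"
proof (induction rule: tree_cograph.induct)
  case (tree T)
  then show ?case
    by (auto simp: undirected_tree_def connected_def strongly_connected_def)
qed (auto simp: graph_union_def graph_complement_def)

lemma graph_complement_complement:
  assumes "pair_graph G"
  shows "graph_complement (graph_complement G) = G"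
proof (cases G)
  case (fields V E)
  have "E \<subseteq> V \<times> V" "irrefl E" using assms by (simp_all add: pair_graph_iff fields)
  then show ?thesis by (auto simp: fields graph_complement_def irrefl_def)
qed

lemma tree_cograph_representable:
  assumes "tree_cograph G"
  shows "(forbidden_free (pverts G) (parcs G) \<longrightarrow> representable (pverts G) (parcs G)) \<and>
    (forbidden_free (pverts (graph_complement G)) (parcs (graph_complement G)) \<longrightarrow>
     representable (pverts (graph_complement G)) (parcs (graph_complement G)))"
  using assms
proof (induction rule: tree_cograph.induct)
  case (tree T)
  then have T: "finite (pverts T)" "sym (parcs T)" "irrefl (parcs T)"
    by (simp_all add: undirected_tree_def pair_graph_iff)
  have "representable (pverts T) (parcs T)"
    using T undirected_tree_acyclic[OF tree] by (rule representable_acyclic)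
  moreover have "representable (pverts T) (parcs (graph_complement T))"
    if "forbidden_free (pverts T) (parcs (graph_complement T))"
    using tree_cograph_nonempty[OF tree_cograph.tree[OF tree]]
      undirected_tree_boundary_edge[OF tree] that
    by (intro representable_cotree[OF T(1) _ T(2,3) undirected_tree_acyclic[OF tree]])
      (auto simp: graph_complement_def)
  ultimately show ?case by (simp add: graph_complement_def)
next
  case (disjoint_union G H)
  have G: "finite (pverts G)" "parcs G \<subseteq> pverts G \<times> pverts G" "pverts G \<noteq> {}"
    and H: "finite (pverts H)" "parcs H \<subseteq> pverts H \<times> pverts H" "pverts H \<noteq> {}"
    using disjoint_union.hyps tree_cograph_imp_pair_graph tree_cograph_nonempty
    by (auto simp: pair_graph_iff)
  let ?U = "graph_union G H"
  have U: "pverts ?U = pverts G \<union> pverts H" "parcs ?U = parcs G \<union> parcs H"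
    by (simp_all add: graph_union_def)
  have eG: "(u, v) \<in> parcs ?U \<longleftrightarrow> (u, v) \<in> parcs G" if "u \<in> pverts G" "v \<in> pverts G" for u v
    using that H(2) disjoint_union.hyps(3) by (auto simp: U)
  have eH: "(u, v) \<in> parcs ?U \<longleftrightarrow> (u, v) \<in> parcs H" if "u \<in> pverts H" "v \<in> pverts H" for u v
    using that G(2) disjoint_union.hyps(3) by (auto simp: U)
  have no: "(u, v) \<notin> parcs ?U \<and> (v, u) \<notin> parcs ?U" if "u \<in> pverts G" "v \<in> pverts H" for u v
    using that G(2) H(2) disjoint_union.hyps(3) by (auto simp: U)
  have "representable (pverts ?U) (parcs ?U)" if free: "forbidden_free (pverts ?U) (parcs ?U)"
  proof -
    have "representable (pverts G) (parcs G)" "representable (pverts H) (parcs H)"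
      using disjoint_union.IH forbidden_free_mono[OF free, of "pverts G" "parcs G"]
        forbidden_free_mono[OF free, of "pverts H" "parcs H"] eG eH by (auto simp: U)
    then have "representable (pverts G) (parcs ?U)" "representable (pverts H) (parcs ?U)"
      using representable_cong[of "pverts G" "parcs ?U" "parcs G"]
        representable_cong[of "pverts H" "parcs ?U" "parcs H"] eG eH by blast+
    then show ?thesis
      unfolding U(1)
      by (rule representable_disjoint_union[OF _ _ G(1) H(1) disjoint_union.hyps(3)]) (rule no)
  qed
  moreover have "representable (pverts ?U) (parcs (graph_complement ?U))"
    if free: "forbidden_free (pverts ?U) (parcs (graph_complement ?U))"
  proof -
    have "pair_graph (graph_complement ?U)"
      using disjoint_union.hyps
      by (intro tree_cograph_imp_pair_graph tree_cograph.complement tree_cograph.disjoint_union)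
    then have C: "sym (parcs (graph_complement ?U))" "irrefl (parcs (graph_complement ?U))"
      by (simp_all add: pair_graph_iff)
    show ?thesis
      unfolding U(1)
    proof (rule representable_join[OF G(1) H(1) G(3) H(3) disjoint_union.hyps(3) C])
      fix a b assume "a \<in> pverts G" "b \<in> pverts H"
      then show "(a, b) \<in> parcs (graph_complement ?U)"
        using no[of a b] disjoint_union.hyps(3) by (auto simp: graph_complement_def U(1))
    qed (use free U(1) in simp)
  qed
  ultimately show ?case by (simp add: graph_complement_def)
next
  case (complement G)
  then show ?case
    using graph_complement_complement[OF tree_cograph_imp_pair_graph[OF complement.hyps]] by simp
qed

theorem theorem19:
  fixes G :: "'a pair_pre_digraph"
  assumes "tree_cograph G"
  shows "contact_B0_VPG G \<longleftrightarrow>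
    induced_free {complete_graph 5, complete_bipartite_graph 3 3, H0, K4_minus} G"
  unfolding contact_B0_VPG_iff induced_free_forbidden_iff[OF tree_cograph_imp_pair_graph[OF assms]]
  using tree_cograph_representable[OF assms] representable_imp_forbidden_free by blast

end
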